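(* Let $r \ge 4$. Then there exists a constant $\alpha_r > 0$ and $t_0=t_0(r)$ such that the following holds for every integer $t\ge t_0$: if $m = \binom{t}{r} - \binom{t-2}{r-2} + s$ where $s$ is an integer with $r \le s \le \alpha_r \binom{t-2}{r-2}$, then there exists an $r$-graph $G$ with $m$ edges such that \[ \lambda(G) > \lambda(\mathcal{C}(m,r)). \]
   Context: An $r$-graph is a finite family $G$ of $r$-element subsets of $\mathbb{N}=\{1,2,\dots\}$ (its edges). A weighting of $\mathbb{N}$ is a function $w:\mathbb{N}\to[0,\infty)$ with $\sum_{x}w(x)=1$; for a set $e$ put $w(e)=\prod_{x\in e}w(x)$ and $w(G)=\sum_{e\in G}w(e)$. The Lagrangian of $G$ is $\lambda(G)=\max\{w(G): w \text{ a weighting of } \mathbb{N}\}$. The colex order on $\mathbb{N}^{(r)}$ is given by $A<B$ iff $\sum_{i\in A}2^i<\sum_{i\in B}2^i$; $\mathcal{C}(m,r)$ denotes the first $m$ sets of $\mathbb{N}^{(r)}$ in colex order. *)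

theory Defs
  imports Complex_Main
begin

text \<open>The ground set is N = {1,2,...}, represented as the naturals \<ge> 1.\<close>

definition r_graph :: "nat \<Rightarrow> nat set set \<Rightarrow> bool" where
  "r_graph r G \<longleftrightarrow> finite G \<and> (\<forall>e\<in>G. e \<subseteq> {1..} \<and> finite e \<and> card e = r)"

definition weighting :: "(nat \<Rightarrow> real) \<Rightarrow> bool" where
  "weighting w \<longleftrightarrow> (\<forall>x. 0 \<le> w x) \<and> w 0 = 0 \<and> w sums 1"

definition weight :: "(nat \<Rightarrow> real) \<Rightarrow> nat set set \<Rightarrow> real" where
  "weight w G = (\<Sum>e\<in>G. \<Prod>x\<in>e. w x)"

definition lagrangian :: "nat set set \<Rightarrow> real" where
  "lagrangian G = Sup {weight w G | w. weighting w}"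

definition colex_key :: "nat set \<Rightarrow> nat" where
  "colex_key A = (\<Sum>i\<in>A. 2 ^ i)"

definition r_sets :: "nat \<Rightarrow> nat set set" where
  "r_sets r = {A. A \<subseteq> {1..} \<and> finite A \<and> card A = r}"

definition colex_initial :: "nat \<Rightarrow> nat \<Rightarrow> nat set set" where
  "colex_initial m r = {A \<in> r_sets r. card {B \<in> r_sets r. colex_key B < colex_key A} < m}"

end

theory Submission
  imports Defs "HOL-Analysis.Convex" "HOL-Library.Nat_Bijection"
begin

text \<open>
  Put \<open>n = t - 2\<close> and \<open>q = r - 2\<close>. The colex graph with \<open>m\<close> edges consists of all \<open>r\<close>-subsets of
  \<open>{1..n+2}\<close> not containing both \<open>n+1\<close> and \<open>n+2\<close>, together with the sets \<open>B \<union> {n+1, n+2}\<close> where \<open>B\<close>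
  runs through the first \<open>s\<close> sets of size \<open>q\<close> in colex order. Replacing these \<open>s\<close> sets by another
  \<open>q\<close>-graph \<open>H\<close> with \<open>s\<close> edges changes the Lagrangian only through the second-order response of the
  optimal weights on \<open>{1..n}\<close>, which deviate from the uniform weighting proportionally to the degrees
  in \<open>H\<close>: the resulting gain is a positive constant times \<open>\<Sum>d(i)\<^sup>2 - (\<Sum>d(i))\<^sup>2/n\<close> up to a small
  relative error. So it suffices that some \<open>H\<close> has a substantially larger degree-square sum than
  the colex family. Since \<open>\<Sum>d(i)\<^sup>2 = \<Sum>|e \<inter> f|\<close> over pairs of edges, a sunflower with a core of size
  \<open>q - 1\<close> is optimal and beats colex as soon as \<open>s \<ge> q + 2\<close>; for large \<open>s\<close> one takes \<open>H\<close> containing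
  as many full vertex stars as possible.
\<close>

section \<open>Elementary symmetric sums\<close>

text \<open>Families with equally many edges agree in \<open>Phi\<close> to first order around
  uniform weights, so their whole difference lies in a second-order term that may be minute. Every
  error must therefore be a small multiple of that term, never an absolute bound. No formula for the
  best weights of the colex graph is at hand, which makes the upper bound the hard half:
  near-optimal weights are confined in two rounds, to O(1/n) each and then to a small total relative
  deviation, before the sharp expansion applies. The weight \<open>y\<close> is never optimised:
  both families are compared at the same \<open>y\<close>, so that terms depending on
  \<open>y\<close> and the edge number alone cancel. The condition r \<le> s, that is q + 2 \<le> s,
  marks the first case in which colex is not itself extremal for degree squares: its first q + 1
  sets are the q-subsets of a (q+1)-set, which pairwise meet in q - 1 points just as in a sunflower.
  For bounded s the degree-square sums are separated only by 1 and n is taken large; for the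
  remaining s they are separated by a constant factor, provided s is a small proportion of all
  q-sets. The threshold depends on q only.\<close>

definition ksets :: "nat set \<Rightarrow> nat \<Rightarrow> nat set set" where
  "ksets A k = {S. S \<subseteq> A \<and> card S = k}"

abbreviation esym :: "nat set \<Rightarrow> nat \<Rightarrow> (nat \<Rightarrow> real) \<Rightarrow> real" where
  "esym A k g \<equiv> weight g (ksets A k)"

lemma finite_ksets [simp]: "finite A \<Longrightarrow> finite (ksets A k)"
  unfolding ksets_def by (rule finite_subset[of _ "Pow A"]) auto

lemma card_ksets: "finite A \<Longrightarrow> card (ksets A k) = card A choose k"
  unfolding ksets_def by (rule n_subsets)

lemma ksetsD: "S \<in> ksets A k \<Longrightarrow> S \<subseteq> A" "S \<in> ksets A k \<Longrightarrow> card S = k"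
  by (auto simp: ksets_def)

lemma ksets_mem: "S \<in> ksets A k \<Longrightarrow> x \<in> S \<Longrightarrow> x \<in> A"
  by (auto simp: ksets_def)

lemma ksets_0 [simp]: "finite A \<Longrightarrow> ksets A 0 = {{}}"
  unfolding ksets_def by (auto dest: finite_subset)

lemma weight_nonneg: "(\<And>e x. e \<in> H \<Longrightarrow> x \<in> e \<Longrightarrow> 0 \<le> g x) \<Longrightarrow> 0 \<le> weight g H"
  unfolding weight_def by (intro sum_nonneg prod_nonneg) auto

lemma weight_mono_graph:
  assumes "finite H'" "H \<subseteq> H'" "\<And>e x. e \<in> H' \<Longrightarrow> x \<in> e \<Longrightarrow> 0 \<le> g x"
  shows "weight g H \<le> weight g H'"
  unfolding weight_def using assms by (intro sum_mono2 prod_nonneg) auto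

lemma weight_cong:
  assumes "\<And>e x. e \<in> H \<Longrightarrow> x \<in> e \<Longrightarrow> f x = g x"
  shows "weight f H = weight g H"
  unfolding weight_def using assms by (intro sum.cong prod.cong refl) auto

lemma esym_cong: "(\<And>i. i \<in> A \<Longrightarrow> f i = g i) \<Longrightarrow> esym A k f = esym A k g"
  by (rule weight_cong) (auto dest: ksetsD)

lemma weight_scale:
  assumes "\<And>e. e \<in> H \<Longrightarrow> card e = k"
  shows "weight (\<lambda>i. c * g i) H = c ^ k * weight g H"
  unfolding weight_def sum_distrib_left
  using assms by (intro sum.cong) (auto simp: prod.distrib)

text \<open>Pairs (S, i) with i outside S correspond to pairs (T, i) with i in T through T = insert
  i S. \<open>esym_Suc\<close>, \<open>esym_square_sum\<close> and \<open>esym_sum_square\<close>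
  are this exchange for three choices of \<open>F\<close>.\<close>

lemma sum_ksets_Suc:
  assumes A: "finite A"
  shows "(\<Sum>S\<in>ksets A k. \<Sum>i\<in>A - S. F S i) = (\<Sum>S\<in>ksets A (Suc k). \<Sum>i\<in>S. F (S - {i}) i)"
proof -
  have fin: "finite S" if "S \<in> ksets A j" for S j
    using that A by (auto simp: ksets_def dest: finite_subset)
  have "(\<Sum>S\<in>ksets A k. \<Sum>i\<in>A - S. F S i) = (\<Sum>(S,i)\<in>Sigma (ksets A k) (\<lambda>S. A - S). F S i)"
    using A by (intro sum.Sigma) auto
  also have "\<dots> = (\<Sum>(S,i)\<in>Sigma (ksets A (Suc k)) (\<lambda>S. S). F (S - {i}) i)"
  proof (rule sum.reindex_bij_witness[where i = "\<lambda>(S,i). (S - {i}, i)" and j = "\<lambda>(S,i). (insert i S, i)"])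
    fix a assume a: "a \<in> Sigma (ksets A k) (\<lambda>S. A - S)"
    obtain S i where S: "a = (S, i)" by (cases a)
    have "S \<in> ksets A k" "i \<in> A" "i \<notin> S" "finite S" using a fin unfolding S by auto
    then show "(case case a of (S, i) \<Rightarrow> (insert i S, i) of (S, i) \<Rightarrow> (S - {i}, i)) = a"
      "(case a of (S, i) \<Rightarrow> (insert i S, i)) \<in> Sigma (ksets A (Suc k)) (\<lambda>S. S)"
      "(case case a of (S, i) \<Rightarrow> (insert i S, i) of (S, i) \<Rightarrow> F (S - {i}) i) = (case a of (S, i) \<Rightarrow> F S i)"
      unfolding S by (simp_all add: ksets_def)
  next
    fix b assume b: "b \<in> Sigma (ksets A (Suc k)) (\<lambda>S. S)"
    obtain S i where S: "b = (S, i)" by (cases b)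
    have "S \<in> ksets A (Suc k)" "i \<in> S" "finite S" using b fin unfolding S by auto
    then show "(case case b of (S, i) \<Rightarrow> (S - {i}, i) of (S, i) \<Rightarrow> (insert i S, i)) = b"
      "(case b of (S, i) \<Rightarrow> (S - {i}, i)) \<in> Sigma (ksets A k) (\<lambda>S. A - S)"
      unfolding S by (auto simp: ksets_def)
  qed
  also have "\<dots> = (\<Sum>S\<in>ksets A (Suc k). \<Sum>i\<in>S. F (S - {i}) i)"
    using A fin by (intro sum.Sigma[symmetric]) auto
  finally show ?thesis .
qed

lemma prod_ksets_remove:
  fixes g :: "nat \<Rightarrow> real"
  assumes "finite A" "S \<in> ksets A k" "i \<in> S"
  shows "(\<Prod>x\<in>S - {i}. g x) * g i = (\<Prod>x\<in>S. g x)"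
proof -
  have "finite S" using assms by (auto dest: ksetsD finite_subset)
  then show ?thesis using prod.remove[OF _ assms(3), of g] by simp
qed

lemma esym_Suc:
  assumes A: "finite A"
  shows "(\<Sum>S\<in>ksets A k. (\<Prod>x\<in>S. g x) * (\<Sum>i\<in>A - S. g i)) = real (Suc k) * esym A (Suc k) g"
proof -
  have "(\<Sum>S\<in>ksets A k. (\<Prod>x\<in>S. g x) * (\<Sum>i\<in>A - S. g i))
      = (\<Sum>S\<in>ksets A (Suc k). \<Sum>i\<in>S. (\<Prod>x\<in>S - {i}. g x) * g i)"
    using sum_ksets_Suc[OF A, where F = "\<lambda>S i. (\<Prod>x\<in>S. g x) * g i"]
    by (simp add: sum_distrib_left)
  also have "\<dots> = (\<Sum>S\<in>ksets A (Suc k). \<Sum>i\<in>S. \<Prod>x\<in>S. g x)"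
    using A by (intro sum.cong refl prod_ksets_remove) auto
  also have "\<dots> = real (Suc k) * esym A (Suc k) g"
    by (simp add: weight_def sum_distrib_left ksetsD(2) del: of_nat_Suc)
  finally show ?thesis .
qed

lemma esym_times_sum:
  assumes A: "finite A"
  shows "(\<Sum>S\<in>ksets A k. (\<Prod>x\<in>S. g x) * (\<Sum>i\<in>S. g i))
       = esym A k g * sum g A - real (Suc k) * esym A (Suc k) g"
proof -
  have split: "prod g S * sum g A = prod g S * sum g S + prod g S * sum g (A - S)"
    if "S \<in> ksets A k" for S
    using sum.subset_diff[OF ksetsD(1)[OF that] A, of g] by (simp add: algebra_simps)
  have "esym A k g * sum g A = (\<Sum>S\<in>ksets A k. prod g S * sum g A)"
    unfolding weight_def by (rule sum_distrib_right)
  also have "\<dots> = (\<Sum>S\<in>ksets A k. prod g S * sum g S + prod g S * sum g (A - S))"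
    by (rule sum.cong[OF refl split])
  finally have "esym A k g * sum g A = (\<Sum>S\<in>ksets A k. prod g S * sum g S + prod g S * sum g (A - S))" .
  then show ?thesis by (simp add: sum.distrib esym_Suc[OF A] del: of_nat_Suc)
qed

lemma esym_square_sum:
  fixes g :: "nat \<Rightarrow> real"
  assumes A: "finite A"
  shows "(\<Sum>S\<in>ksets A k. (\<Prod>x\<in>S. g x) * (\<Sum>i\<in>A - S. (g i)\<^sup>2))
       = (\<Sum>S\<in>ksets A (Suc k). (\<Prod>x\<in>S. g x) * (\<Sum>i\<in>S. g i))"
proof -
  have rem: "(\<Prod>x\<in>S - {i}. g x) * (g i)\<^sup>2 = (\<Prod>x\<in>S. g x) * g i"
    if "S \<in> ksets A (Suc k)" "i \<in> S" for S i
    using prod_ksets_remove[OF A that, of g] by (simp add: power2_eq_square flip: mult.assoc)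
  have "(\<Sum>S\<in>ksets A k. (\<Prod>x\<in>S. g x) * (\<Sum>i\<in>A - S. (g i)\<^sup>2))
      = (\<Sum>S\<in>ksets A (Suc k). \<Sum>i\<in>S. (\<Prod>x\<in>S - {i}. g x) * (g i)\<^sup>2)"
    using sum_ksets_Suc[OF A, where F = "\<lambda>S i. (\<Prod>x\<in>S. g x) * (g i)\<^sup>2"]
    by (simp add: sum_distrib_left)
  also have "\<dots> = (\<Sum>S\<in>ksets A (Suc k). \<Sum>i\<in>S. (\<Prod>x\<in>S. g x) * g i)"
    using rem by (intro sum.cong refl) auto
  finally show ?thesis by (simp add: sum_distrib_left)
qed

text \<open>Expanding the square, the terms with equal indices give the sum from
  \<open>esym_square_sum\<close>; those with distinct i, j extend S to a (k+2)-set, which arises in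
  (k+1)(k+2) ordered ways.\<close>

lemma esym_sum_square:
  assumes A: "finite A"
  shows "(\<Sum>S\<in>ksets A k. (\<Prod>x\<in>S. g x) * (\<Sum>i\<in>A - S. g i)\<^sup>2)
       = (\<Sum>S\<in>ksets A (Suc k). (\<Prod>x\<in>S. g x) * (\<Sum>i\<in>S. g i))
         + real (Suc k) * real (Suc (Suc k)) * esym A (Suc (Suc k)) g"
proof -
  have diff: "(\<Sum>j\<in>A - (S - {i}). g j) = g i + (\<Sum>j\<in>A - S. g j)"
    if "S \<in> ksets A (Suc k)" "i \<in> S" for S i
  proof -
    have "A - (S - {i}) = insert i (A - S)" using that by (auto dest: ksetsD)
    then show ?thesis using that A by simp
  qed
  have "(\<Sum>S\<in>ksets A k. (\<Prod>x\<in>S. g x) * (\<Sum>i\<in>A - S. g i)\<^sup>2)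
      = (\<Sum>S\<in>ksets A k. \<Sum>i\<in>A - S. ((\<Prod>x\<in>S. g x) * g i) * (\<Sum>j\<in>A - S. g j))"
    by (simp add: power2_eq_square sum_distrib_left sum_distrib_right mult_ac)
  also have "\<dots> = (\<Sum>S\<in>ksets A (Suc k). \<Sum>i\<in>S. ((\<Prod>x\<in>S - {i}. g x) * g i) * (\<Sum>j\<in>A - (S - {i}). g j))"
    by (rule sum_ksets_Suc[OF A])
  also have "\<dots> = (\<Sum>S\<in>ksets A (Suc k). \<Sum>i\<in>S. (\<Prod>x\<in>S. g x) * (g i + (\<Sum>j\<in>A - S. g j)))"
    using prod_ksets_remove[OF A] diff by (intro sum.cong refl) auto
  also have "\<dots> = (\<Sum>S\<in>ksets A (Suc k). (\<Prod>x\<in>S. g x) * (\<Sum>i\<in>S. g i)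
                      + real (Suc k) * ((\<Prod>x\<in>S. g x) * (\<Sum>j\<in>A - S. g j)))"
    by (intro sum.cong refl)
       (simp add: sum.distrib sum_distrib_left[symmetric] ksetsD(2) distrib_left)
  also have "\<dots> = (\<Sum>S\<in>ksets A (Suc k). (\<Prod>x\<in>S. g x) * (\<Sum>i\<in>S. g i))
         + real (Suc k) * real (Suc (Suc k)) * esym A (Suc (Suc k)) g"
    by (simp add: sum.distrib sum_distrib_left[symmetric] esym_Suc[OF A] del: of_nat_Suc)
  finally show ?thesis .
qed

lemma esym_1 [simp]: "finite A \<Longrightarrow> esym A (Suc 0) g = sum g A"
  using esym_Suc[where A = A and g = g and k = 0] by simp

lemma esym_2:
  assumes "finite A"
  shows "esym A 2 g = ((sum g A)\<^sup>2 - (\<Sum>i\<in>A. (g i)\<^sup>2)) / 2"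
  using esym_sum_square[OF assms, where g = g and k = 0] esym_square_sum[OF assms, where g = g and k = 0] assms
  by (simp add: numeral_2_eq_2)

text \<open>Maclaurin's comparison of consecutive symmetric means. For every (k-1)-set S,
  Cauchy-Schwarz on the card A - k + 1 elements outside S bounds the squared sum by the sum of
  squares. Weighted by the product over S and summed, both sides are linear in \<open>X\<close> and
  \<open>E\<close>.\<close>

lemma esym_newton:
  assumes A: "finite A" and g: "\<And>i. i \<in> A \<Longrightarrow> 0 \<le> g i" and k: "k < card A"
  shows "real (card A) * real (Suc k) * esym A (Suc k) g \<le> real (card A - k) * esym A k g * sum g A"
proof (cases k)
  case 0
  have "esym A 0 g = 1" using A by (simp add: weight_def)
  then show ?thesis using 0 A by simp
next
  case (Suc j)
  define X where "X = (\<Sum>S\<in>ksets A (Suc j). (\<Prod>x\<in>S. g x) * (\<Sum>i\<in>S. g i))"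
  define E where "E = real (Suc k) * esym A (Suc k) g"
  have X: "X = esym A k g * sum g A - E"
    unfolding X_def E_def Suc by (rule esym_times_sum[OF A])
  have "X + real k * E = (\<Sum>S\<in>ksets A j. (\<Prod>x\<in>S. g x) * (\<Sum>i\<in>A - S. g i)\<^sup>2)"
    unfolding X_def E_def Suc esym_sum_square[OF A] by simp
  also have "\<dots> \<le> (\<Sum>S\<in>ksets A j. (\<Prod>x\<in>S. g x) * (real (card A - j) * (\<Sum>i\<in>A - S. (g i)\<^sup>2)))"
  proof (intro sum_mono mult_left_mono)
    fix S assume S: "S \<in> ksets A j"
    then have "card (A - S) = card A - j"
      using A by (metis card_Diff_subset finite_subset ksetsD)
    then show "(\<Sum>i\<in>A - S. g i)\<^sup>2 \<le> real (card A - j) * (\<Sum>i\<in>A - S. (g i)\<^sup>2)"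
      using sum_squared_le_sum_of_squares[of g "A - S"] by (simp add: mult.commute)
    show "0 \<le> (\<Prod>x\<in>S. g x)" using S g by (intro prod_nonneg) (auto dest: ksetsD)
  qed
  also have "\<dots> = real (card A - j) * X"
    unfolding X_def esym_square_sum[OF A, symmetric] by (simp add: sum_distrib_left mult_ac)
  also have "\<dots> = real (card A - k) * X + X"
    using k Suc by (simp add: of_nat_diff algebra_simps)
  finally have "real k * E \<le> real (card A - k) * (esym A k g * sum g A - E)"
    unfolding X by simp
  then have "(real k + real (card A - k)) * E \<le> real (card A - k) * esym A k g * sum g A"
    by (simp add: algebra_simps)
  then show ?thesis using k unfolding E_def by (simp add: of_nat_diff mult.assoc)
qed

lemma esym_eq_0:
  assumes "finite A" "card A < k"
  shows "esym A k g = 0"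
proof -
  have "S \<notin> ksets A k" for S
    using assms card_mono[OF assms(1), of S] unfolding ksets_def by auto
  then have "ksets A k = {}" by blast
  then show ?thesis by (simp add: weight_def)
qed

lemma esym_nonneg: "(\<And>i. i \<in> A \<Longrightarrow> 0 \<le> g i) \<Longrightarrow> 0 \<le> esym A k g"
  by (rule weight_nonneg) (auto dest: ksetsD)

lemma binomial_step: "k < n \<Longrightarrow> real (n choose Suc k) * real (Suc k) = real (n choose k) * real (n - k)"
proof -
  assume "k < n"
  then have "Suc k * (n choose Suc k) = (n - k) * (n choose k)"
    using binomial_absorption[of k n] binomial_absorb_comp[of n k] by simp
  then show ?thesis by (metis mult.commute of_nat_mult)
qed

text \<open>With mean 1, \<open>esym_newton\<close> says that the symmetric sums divided by their
  binomial coefficients do not increase with k, so a saving gained at one level persists at all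
  higher ones. Beyond card A both sides are 0.\<close>

lemma esym_mono_normalised:
  assumes A: "finite A" and g: "\<And>i. i \<in> A \<Longrightarrow> 0 \<le> g i" and sum: "sum g A = real (card A)"
    and j: "j \<le> k" and c: "esym A j g \<le> c * real (card A choose j)"
  shows "esym A k g \<le> c * real (card A choose k)"
  using j
proof (induction k rule: dec_induct)
  case base
  show ?case by (rule c)
next
  case (step k)
  show ?case
  proof (cases "k < card A")
    case True
    have "real (card A) * (real (Suc k) * esym A (Suc k) g) \<le> real (card A) * (real (card A - k) * esym A k g)"
      using esym_newton[OF A _ True, of g] g sum by (simp add: mult_ac)
    then have "real (Suc k) * esym A (Suc k) g \<le> real (card A - k) * esym A k g"
      using True by (simp add: mult_le_cancel_left_pos)
    also have "\<dots> \<le> real (card A - k) * (c * real (card A choose k))"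
      by (intro mult_left_mono step.IH) auto
    also have "\<dots> = real (Suc k) * (c * real (card A choose Suc k))"
      using binomial_step[OF True] by (simp add: mult_ac)
    finally show ?thesis by (rule mult_left_le_imp_le) simp
  next
    case False
    then show ?thesis using esym_eq_0[OF A, of "Suc k" g] by (simp add: binomial_eq_0)
  qed
qed

lemma esym_le_binomial:
  assumes "finite A" "\<And>i. i \<in> A \<Longrightarrow> 0 \<le> g i" "sum g A = real (card A)"
  shows "esym A k g \<le> real (card A choose k)"
  using esym_mono_normalised[OF assms, where j = 0 and c = 1] assms(1) by (simp add: weight_def)

lemma sum_square_deviation:
  fixes g :: "nat \<Rightarrow> real"
  assumes "sum g A = real (card A)"
  shows "(\<Sum>i\<in>A. (g i)\<^sup>2) = real (card A) + (\<Sum>i\<in>A. (g i - 1)\<^sup>2)"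
proof -
  have "(\<Sum>i\<in>A. (g i - 1)\<^sup>2) = (\<Sum>i\<in>A. (g i)\<^sup>2 - 2 * g i + 1)"
    by (intro sum.cong) (auto simp: power2_eq_square algebra_simps)
  then show ?thesis
    using assms by (simp add: sum.distrib sum_subtractf sum_distrib_left[symmetric])
qed

text \<open>At level 2 the saving is exact: the sum falls short of its maximum by half the sum
  \<open>U\<close> of squared deviations, a proportion U / (N (N - 1)), and monotonicity carries
  this up. For small deviations the true loss at level k is larger by a factor of order k^2, but the
  present bound asks for no smallness.\<close>

lemma esym_le_variance:
  assumes A: "finite A" and g: "\<And>i. i \<in> A \<Longrightarrow> 0 \<le> g i" and sum: "sum g A = real (card A)"
    and k: "2 \<le> k" and N: "2 \<le> card A"
  shows "esym A k g \<le> (1 - (\<Sum>i\<in>A. (g i - 1)\<^sup>2) / (real (card A))\<^sup>2) * real (card A choose k)"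
proof (rule esym_mono_normalised[OF A g sum k])
  define N where "N = real (card A)"
  define U where "U = (\<Sum>i\<in>A. (g i - 1)\<^sup>2)"
  have N2: "N \<ge> 2" using N unfolding N_def by simp
  have U: "U \<ge> 0" unfolding U_def by (intro sum_nonneg) auto
  have C: "real (card A choose 2) = N * (N - 1) / 2"
    using N unfolding N_def choose_two
    by (subst real_of_nat_div) (auto simp: of_nat_diff)
  have "esym A 2 g = N * (N - 1) / 2 - U / 2"
    unfolding esym_2[OF A] sum sum_square_deviation[OF sum] N_def U_def
    by (simp add: power2_eq_square field_simps)
  moreover have "U / N\<^sup>2 * (N * (N - 1) / 2) \<le> U / 2"
    using N2 U by (simp add: power2_eq_square field_simps)
  ultimately show "esym A 2 g \<le> (1 - U / N\<^sup>2) * real (card A choose 2)"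
    unfolding C by (simp add: left_diff_distrib)
qed

section \<open>Expansion around the uniform weighting\<close>

lemma card_ksets_superset:
  assumes A: "finite A" and T: "T \<subseteq> A" "card T \<le> k"
  shows "card {S \<in> ksets A k. T \<subseteq> S} = (card A - card T) choose (k - card T)"
proof -
  have fT: "finite T" using A T finite_subset by blast
  have "bij_betw (\<lambda>S. S \<union> T) (ksets (A - T) (k - card T)) {S \<in> ksets A k. T \<subseteq> S}"
  proof (rule bij_betw_byWitness[where f' = "\<lambda>S. S - T"])
    show "\<forall>S\<in>ksets (A - T) (k - card T). S \<union> T - T = S"
      by (auto simp: ksets_def)
    show "\<forall>S\<in>{S \<in> ksets A k. T \<subseteq> S}. S - T \<union> T = S" by auto
    show "(\<lambda>S. S \<union> T) ` ksets (A - T) (k - card T) \<subseteq> {S \<in> ksets A k. T \<subseteq> S}"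
    proof clarify
      fix S assume S: "S \<in> ksets (A - T) (k - card T)"
      then have "finite S" "S \<inter> T = {}" using A by (auto simp: ksets_def dest: finite_subset)
      then have "card (S \<union> T) = k" using S fT T by (simp add: card_Un_disjoint ksets_def)
      then show "S \<union> T \<in> ksets A k \<and> T \<subseteq> S \<union> T" using S T by (auto simp: ksets_def)
    qed
    show "(\<lambda>S. S - T) ` {S \<in> ksets A k. T \<subseteq> S} \<subseteq> ksets (A - T) (k - card T)"
      using fT by (auto simp: ksets_def card_Diff_subset)
  qed
  then have "card {S \<in> ksets A k. T \<subseteq> S} = card (ksets (A - T) (k - card T))"
    by (simp add: bij_betw_same_card)
  also have "\<dots> = (card A - card T) choose (k - card T)"
    using A T fT by (simp add: card_ksets card_Diff_subset)
  finally show ?thesis .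
qed

text \<open>Each product over S expands over the subsets T of S. With the order of summation
  reversed, a set T of size j is counted once for every k-set containing it.\<close>

lemma esym_one_plus:
  assumes A: "finite A"
  shows "esym A k (\<lambda>i. 1 + u i) = (\<Sum>j\<le>k. real ((card A - j) choose (k - j)) * esym A j u)"
proof -
  let ?P = "{T \<in> Pow A. card T \<le> k}"
  have fP: "finite ?P" using A by simp
  have sub: "Pow S = {T \<in> ?P. T \<subseteq> S}" if "S \<in> ksets A k" for S
  proof -
    have "S \<subseteq> A" "card S = k" using that by (auto simp: ksets_def)
    then show ?thesis using A by (auto intro: card_mono dest: finite_subset)
  qed
  have "esym A k (\<lambda>i. 1 + u i) = (\<Sum>S\<in>ksets A k. \<Sum>T | T \<in> ?P \<and> T \<subseteq> S. \<Prod>x\<in>T. u x)"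
    unfolding weight_def
  proof (rule sum.cong[OF refl])
    fix S assume S: "S \<in> ksets A k"
    then have fS: "finite S" using A by (auto simp: ksets_def dest: finite_subset)
    have "(\<Prod>x\<in>S. 1 + u x) = (\<Prod>x\<in>S. u x + 1)" by (simp add: add.commute)
    also have "\<dots> = (\<Sum>T\<in>Pow S. \<Prod>x\<in>T. u x)"
      using fS by (simp add: prod_add)
    finally show "(\<Prod>x\<in>S. 1 + u x) = (\<Sum>T | T \<in> ?P \<and> T \<subseteq> S. \<Prod>x\<in>T. u x)"
      unfolding sub[OF S] .
  qed
  also have "\<dots> = (\<Sum>T\<in>?P. \<Sum>S | S \<in> ksets A k \<and> T \<subseteq> S. \<Prod>x\<in>T. u x)"
    by (rule sum.swap_restrict[OF finite_ksets[OF A] fP])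
  also have "\<dots> = (\<Sum>T\<in>?P. real ((card A - card T) choose (k - card T)) * (\<Prod>x\<in>T. u x))"
    by (rule sum.cong[OF refl]) (simp add: card_ksets_superset[OF A])
  also have "\<dots> = (\<Sum>j\<le>k. \<Sum>T | T \<in> ?P \<and> card T = j. real ((card A - card T) choose (k - card T)) * (\<Prod>x\<in>T. u x))"
    by (rule sum.group[symmetric, OF fP]) auto
  also have "\<dots> = (\<Sum>j\<le>k. real ((card A - j) choose (k - j)) * esym A j u)"
    unfolding weight_def sum_distrib_left
    by (rule sum.cong[OF refl]) (auto simp: ksets_def intro!: sum.cong)
  finally show ?thesis .
qed

lemma abs_weight_le: "\<bar>weight u H\<bar> \<le> weight (\<lambda>i. \<bar>u i\<bar>) H"
  unfolding weight_def by (rule order_trans[OF sum_abs]) (simp add: abs_prod)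

lemma esym_le_power:
  assumes A: "finite A" and g: "\<And>i. i \<in> A \<Longrightarrow> 0 \<le> g i"
  shows "esym A k g \<le> (sum g A) ^ k"
proof (induction k)
  case 0
  then show ?case using A by (simp add: weight_def)
next
  case (Suc k)
  have "0 \<le> (\<Sum>S\<in>ksets A k. (\<Prod>x\<in>S. g x) * (\<Sum>i\<in>S. g i))"
    using g by (intro sum_nonneg mult_nonneg_nonneg prod_nonneg) (auto dest: ksetsD)
  then have "real (Suc k) * esym A (Suc k) g \<le> esym A k g * sum g A"
    unfolding esym_times_sum[OF A] by simp
  moreover have "0 \<le> real k * esym A (Suc k) g" using esym_nonneg[of A g "Suc k"] g by simp
  ultimately have "esym A (Suc k) g \<le> esym A k g * sum g A"
    by (simp add: distrib_right)
  also have "\<dots> \<le> sum g A ^ k * sum g A"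
    using Suc g by (intro mult_right_mono sum_nonneg) auto
  finally show ?case by (simp add: mult.commute)
qed

lemma binomial_le_power: "real (n choose k) \<le> real n ^ k"
proof (cases "k \<le> n")
  case True
  then show ?thesis using binomial_le_pow[OF True] by (metis of_nat_le_iff of_nat_power)
qed (simp add: binomial_eq_0)

text \<open>In the expansion by \<open>esym_one_plus\<close> the linear term vanishes and the
  quadratic one is minus half the sum U of squares. The terms of degree at least 3 are cubic in the
  total deviation s; Cauchy-Schwarz, s^2 \<le> N U, trades two factors s for U, so the error is
  below the order of the quadratic term by a factor s.\<close>

lemma esym_local:
  assumes A: "finite A" and N: "1 \<le> card A" and u0: "sum u A = 0" and k: "3 \<le> k"
    and s1: "(\<Sum>i\<in>A. \<bar>u i\<bar>) \<le> 1"
  shows "\<bar>esym A k (\<lambda>i. 1 + u i)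
      - (real (card A choose k) - real ((card A - 2) choose (k - 2)) * (\<Sum>i\<in>A. (u i)\<^sup>2) / 2)\<bar>
    \<le> real k * real (card A) ^ (k - 2) * (\<Sum>i\<in>A. \<bar>u i\<bar>) * (\<Sum>i\<in>A. (u i)\<^sup>2)"
proof -
  define N where "N = card A"
  define s where "s = (\<Sum>i\<in>A. \<bar>u i\<bar>)"
  define U where "U = (\<Sum>i\<in>A. (u i)\<^sup>2)"
  have s0: "0 \<le> s" "s \<le> 1" using s1 unfolding s_def by (auto intro: sum_nonneg)
  have U0: "0 \<le> U" unfolding U_def by (auto intro: sum_nonneg)
  have sU: "s\<^sup>2 \<le> N * U"
    using sum_squared_le_sum_of_squares[of "\<lambda>i. \<bar>u i\<bar>" A]
    unfolding s_def U_def N_def by (simp add: mult.commute)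
  define T where "T j = real ((N - j) choose (k - j)) * esym A j u" for j
  have "{..k} = {0, 1, 2} \<union> {3..k}" using k by auto
  then have "sum T {..k} = T 0 + T 1 + T 2 + sum T {3..k}"
    by (simp add: sum.union_disjoint)
  moreover have "T 0 = real (N choose k)" using A by (simp add: T_def weight_def)
  moreover have "T 1 = 0" using A u0 by (simp add: T_def)
  moreover have "T 2 = - real ((N - 2) choose (k - 2)) * U / 2"
    unfolding T_def esym_2[OF A] u0 U_def by simp
  ultimately have eq: "esym A k (\<lambda>i. 1 + u i) - (real (N choose k) - real ((N - 2) choose (k - 2)) * U / 2)
      = sum T {3..k}"
    unfolding esym_one_plus[OF A] N_def[symmetric] T_def[symmetric] by simp
  have T3: "\<bar>T j\<bar> \<le> real N ^ (k - 3) * s ^ 3" if "j \<in> {3..k}" for j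
  proof -
    have "real ((N - j) choose (k - j)) \<le> real (N - j) ^ (k - j)" by (rule binomial_le_power)
    also have "\<dots> \<le> real N ^ (k - j)" by (intro power_mono) auto
    also have "\<dots> \<le> real N ^ (k - 3)" using that N by (intro power_increasing) (auto simp: N_def)
    finally have b: "real ((N - j) choose (k - j)) \<le> real N ^ (k - 3)" .
    have "\<bar>esym A j u\<bar> \<le> s ^ j"
      unfolding s_def by (rule order_trans[OF abs_weight_le esym_le_power[OF A]]) simp
    also have "\<dots> \<le> s ^ 3" using that s0 by (intro power_decreasing) auto
    finally show ?thesis unfolding T_def abs_mult using b by (intro mult_mono) auto
  qed
  have "\<bar>sum T {3..k}\<bar> \<le> (\<Sum>j\<in>{3..k}. \<bar>T j\<bar>)" by (rule sum_abs)
  also have "\<dots> \<le> real (card {3..k}) * (real N ^ (k - 3) * s ^ 3)"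
    using T3 by (intro sum_bounded_above)
  also have "\<dots> \<le> real k * (real N ^ (k - 3) * s ^ 3)"
    using s0 by (intro mult_right_mono mult_nonneg_nonneg) auto
  also have "\<dots> \<le> real k * (real N ^ (k - 3) * (s * (N * U)))"
    using s0 sU by (intro mult_left_mono) (auto simp: power3_eq_cube power2_eq_square mult.assoc intro!: mult_left_mono)
  also have "\<dots> = real k * real N ^ Suc (k - 3) * s * U" by (simp add: mult_ac)
  also have "Suc (k - 3) = k - 2" using k by simp
  finally show ?thesis using eq unfolding N_def s_def U_def by simp
qed

text \<open>Induction on the number of factors; the cross term \<open>u a * S\<close> is turned into
  squares by 2ab \<le> a^2 + b^2. The deviations are merely bounded by some \<open>M\<close>,
  because the upper estimate uses this before they are known to be small. The error is quadratic so
  that the curvature can absorb it.\<close>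

lemma prod_one_plus_approx:
  fixes M :: real
  assumes "0 \<le> M"
  shows "\<exists>K\<ge>0. \<forall>(e::nat set) u. finite e \<and> card e = q \<and> (\<forall>i\<in>e. \<bar>u i\<bar> \<le> M) \<longrightarrow>
    \<bar>(\<Prod>i\<in>e. 1 + u i) - 1 - (\<Sum>i\<in>e. u i)\<bar> \<le> K * (\<Sum>i\<in>e. (u i)\<^sup>2)"
proof (induction q)
  case 0
  then show ?case by (intro exI[of _ 0]) auto
next
  case (Suc q)
  then obtain K where K: "K \<ge> 0" and IH: "\<And>(e::nat set) u. finite e \<Longrightarrow> card e = q \<Longrightarrow> (\<forall>i\<in>e. \<bar>u i\<bar> \<le> M) \<Longrightarrow>
    \<bar>(\<Prod>i\<in>e. 1 + u i) - 1 - (\<Sum>i\<in>e. u i)\<bar> \<le> K * (\<Sum>i\<in>e. (u i)\<^sup>2)" by blast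
  show ?case
  proof (intro exI[of _ "(1 + M) * K + q + 1"] conjI allI impI)
    show "0 \<le> (1 + M) * K + q + 1" using K assms by simp
    fix e :: "nat set" and u assume *: "finite e \<and> card e = Suc q \<and> (\<forall>i\<in>e. \<bar>u i\<bar> \<le> M)"
    then obtain a f where e: "e = insert a f" "a \<notin> f" "card f = q" by (auto simp: card_Suc_eq)
    then have f: "finite f" "\<forall>i\<in>f. \<bar>u i\<bar> \<le> M" "\<bar>u a\<bar> \<le> M" using * by auto
    define P S Q where "P = (\<Prod>i\<in>f. 1 + u i)" and "S = (\<Sum>i\<in>f. u i)" and "Q = (\<Sum>i\<in>f. (u i)\<^sup>2)"
    have Q: "0 \<le> Q" unfolding Q_def by (auto intro: sum_nonneg)
    have PS: "\<bar>P - 1 - S\<bar> \<le> K * Q" using IH[of f u] e f unfolding P_def S_def Q_def by auto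
    have "\<bar>u a * S\<bar> \<le> (\<Sum>i\<in>f. \<bar>u a * u i\<bar>)" unfolding S_def sum_distrib_left by (rule sum_abs)
    also have "\<dots> \<le> (\<Sum>i\<in>f. (u a)\<^sup>2 + (u i)\<^sup>2)"
    proof (rule sum_mono)
      fix i
      have "2 * (\<bar>u a\<bar> * \<bar>u i\<bar>) \<le> (u a)\<^sup>2 + (u i)\<^sup>2"
        using sum_squares_bound[of "\<bar>u a\<bar>" "\<bar>u i\<bar>"] by simp
      moreover have "0 \<le> \<bar>u a\<bar> * \<bar>u i\<bar>" by simp
      ultimately show "\<bar>u a * u i\<bar> \<le> (u a)\<^sup>2 + (u i)\<^sup>2" unfolding abs_mult by linarith
    qed
    also have "\<dots> = q * (u a)\<^sup>2 + Q" using e by (simp add: sum.distrib Q_def)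
    finally have uS: "\<bar>u a * S\<bar> \<le> q * (u a)\<^sup>2 + Q" .
    have "\<bar>(1 + u a) * (P - 1 - S)\<bar> \<le> (1 + M) * (K * Q)"
      unfolding abs_mult using PS f(3) assms by (intro mult_mono) auto
    moreover have "(\<Prod>i\<in>e. 1 + u i) - 1 - (\<Sum>i\<in>e. u i) = (1 + u a) * (P - 1 - S) + u a * S"
      using e f by (simp add: P_def S_def algebra_simps)
    ultimately have "\<bar>(\<Prod>i\<in>e. 1 + u i) - 1 - (\<Sum>i\<in>e. u i)\<bar> \<le> (1 + M) * (K * Q) + (q * (u a)\<^sup>2 + Q)"
      using uS by linarith
    also have "\<dots> \<le> ((1 + M) * K + q + 1) * ((u a)\<^sup>2 + Q)"
    proof -
      have "0 \<le> (1 + M) * K * (u a)\<^sup>2" "0 \<le> q * Q" using K Q assms by auto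
      then show ?thesis by (simp add: algebra_simps)
    qed
    also have "(u a)\<^sup>2 + Q = (\<Sum>i\<in>e. (u i)\<^sup>2)" using e f by (simp add: Q_def)
    finally show "\<bar>(\<Prod>i\<in>e. 1 + u i) - 1 - (\<Sum>i\<in>e. u i)\<bar> \<le> ((1 + M) * K + q + 1) * (\<Sum>i\<in>e. (u i)\<^sup>2)" .
  qed
qed

section \<open>Degrees and the linearised weight of an edge family\<close>

definition deg :: "nat set set \<Rightarrow> nat \<Rightarrow> nat" where
  "deg H i = card {e \<in> H. i \<in> e}"

lemma sum_deg:
  fixes f :: "nat \<Rightarrow> real"
  assumes A: "finite A" and H: "H \<subseteq> ksets A q"
  shows "(\<Sum>e\<in>H. \<Sum>i\<in>e. f i) = (\<Sum>i\<in>A. real (deg H i) * f i)"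
proof -
  have fH: "finite H" using finite_subset[OF H] A by simp
  have "(\<Sum>e\<in>H. \<Sum>i\<in>e. f i) = (\<Sum>e\<in>H. \<Sum>i | i \<in> A \<and> i \<in> e. f i)"
    by (rule sum.cong[OF refl], rule sum.cong) (use H in \<open>auto simp: ksets_def\<close>)
  also have "\<dots> = (\<Sum>i\<in>A. \<Sum>e | e \<in> H \<and> i \<in> e. f i)"
    by (rule sum.swap_restrict[OF fH A])
  finally show ?thesis by (simp add: deg_def)
qed

lemma sum_deg_eq:
  assumes A: "finite A" and H: "H \<subseteq> ksets A q"
  shows "(\<Sum>i\<in>A. real (deg H i)) = real q * real (card H)"
proof -
  have "(\<Sum>i\<in>A. real (deg H i)) = (\<Sum>e\<in>H. \<Sum>i\<in>e. 1)"
    using sum_deg[OF A H, of "\<lambda>_. 1"] by simp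
  also have "\<dots> = (\<Sum>e\<in>H. real q)"
    by (rule sum.cong[OF refl]) (use H in \<open>auto simp: ksets_def\<close>)
  finally show ?thesis by simp
qed

lemma deg_le:
  assumes A: "finite A" and H: "H \<subseteq> ksets A q" and q: "1 \<le> q"
  shows "deg H i \<le> (card A - 1) choose (q - 1)"
proof (cases "i \<in> A")
  case True
  have "deg H i \<le> card {S \<in> ksets A q. {i} \<subseteq> S}"
    unfolding deg_def using A H by (intro card_mono) auto
  then show ?thesis using card_ksets_superset[OF A, of "{i}" q] True q by simp
next
  case False
  then have "{e \<in> H. i \<in> e} = {}" using H by (auto simp: ksets_def)
  then have "deg H i = 0" unfolding deg_def by (simp only: card.empty)
  then show ?thesis by simp
qed

lemma deg_le_power:
  assumes "finite A" "H \<subseteq> ksets A q" "1 \<le> q"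
  shows "real (deg H i) \<le> real (card A) ^ (q - 1)"
proof -
  have "real (deg H i) \<le> real ((card A - 1) choose (q - 1))"
    using deg_le[OF assms] by simp
  also have "\<dots> \<le> real (card A - 1) ^ (q - 1)" by (rule binomial_le_power)
  also have "\<dots> \<le> real (card A) ^ (q - 1)" by (intro power_mono) auto
  finally show ?thesis .
qed

lemma sum_deg_square_le:
  assumes "finite A" "H \<subseteq> ksets A q" "1 \<le> q"
  shows "(\<Sum>i\<in>A. (real (deg H i))\<^sup>2) \<le> real (card A) ^ (q - 1) * (real q * real (card H))"
proof -
  have "(\<Sum>i\<in>A. (real (deg H i))\<^sup>2) \<le> (\<Sum>i\<in>A. real (card A) ^ (q - 1) * real (deg H i))"
    unfolding power2_eq_square by (intro sum_mono mult_right_mono deg_le_power assms) auto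
  then show ?thesis unfolding sum_distrib_left[symmetric] sum_deg_eq[OF assms(1,2)] .
qed

text \<open>Summed over the edges, each squared deviation is counted once per edge at its vertex,
  hence at most n^(q-1) times. This exponent is one less than that of \<open>slope_le_curv\<close>,
  which is the origin of the relative error 1/n in \<open>Phi_local\<close>.\<close>

lemma weight_one_plus_approx:
  fixes M :: real
  assumes "0 \<le> M" and q: "1 \<le> q"
  shows "\<exists>K\<ge>0. \<forall>A H u. finite A \<and> H \<subseteq> ksets A q \<and> (\<forall>i\<in>A. \<bar>u i\<bar> \<le> M) \<longrightarrow>
    \<bar>weight (\<lambda>i. 1 + u i) H - real (card H) - (\<Sum>i\<in>A. real (deg H i) * u i)\<bar>
      \<le> K * real (card A) ^ (q - 1) * (\<Sum>i\<in>A. (u i)\<^sup>2)"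
proof -
  obtain K where K: "K \<ge> 0" and approx: "\<And>(e::nat set) u. finite e \<Longrightarrow> card e = q \<Longrightarrow> (\<forall>i\<in>e. \<bar>u i\<bar> \<le> M) \<Longrightarrow>
    \<bar>(\<Prod>i\<in>e. 1 + u i) - 1 - (\<Sum>i\<in>e. u i)\<bar> \<le> K * (\<Sum>i\<in>e. (u i)\<^sup>2)"
    using prod_one_plus_approx[OF assms(1), of q] by blast
  show ?thesis
  proof (intro exI[of _ K] conjI allI impI K)
    fix A :: "nat set" and H and u :: "nat \<Rightarrow> real"
    assume *: "finite A \<and> H \<subseteq> ksets A q \<and> (\<forall>i\<in>A. \<bar>u i\<bar> \<le> M)"
    then have A: "finite A" and H: "H \<subseteq> ksets A q" and u: "\<forall>i\<in>A. \<bar>u i\<bar> \<le> M" by auto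
    have "weight (\<lambda>i. 1 + u i) H - real (card H) - (\<Sum>i\<in>A. real (deg H i) * u i)
        = (\<Sum>e\<in>H. (\<Prod>i\<in>e. 1 + u i) - 1 - (\<Sum>i\<in>e. u i))"
      unfolding weight_def sum_deg[OF A H, symmetric] by (simp add: sum_subtractf)
    also have "\<bar>\<dots>\<bar> \<le> (\<Sum>e\<in>H. K * (\<Sum>i\<in>e. (u i)\<^sup>2))"
    proof (rule order_trans[OF sum_abs], rule sum_mono)
      fix e assume "e \<in> H"
      then have "e \<subseteq> A" "card e = q" using H by (auto simp: ksets_def)
      then show "\<bar>(\<Prod>i\<in>e. 1 + u i) - 1 - (\<Sum>i\<in>e. u i)\<bar> \<le> K * (\<Sum>i\<in>e. (u i)\<^sup>2)"
        using A u by (intro approx) (auto dest: finite_subset)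
    qed
    also have "\<dots> = K * (\<Sum>i\<in>A. real (deg H i) * (u i)\<^sup>2)"
      unfolding sum_distrib_left[symmetric] sum_deg[OF A H] ..
    also have "\<dots> \<le> K * (\<Sum>i\<in>A. real (card A) ^ (q - 1) * (u i)\<^sup>2)"
      using K A H q by (intro mult_left_mono sum_mono mult_right_mono deg_le_power) auto
    finally show "\<bar>weight (\<lambda>i. 1 + u i) H - real (card H) - (\<Sum>i\<in>A. real (deg H i) * u i)\<bar>
      \<le> K * real (card A) ^ (q - 1) * (\<Sum>i\<in>A. (u i)\<^sup>2)"
      by (simp add: sum_distrib_left[symmetric] mult.assoc)
  qed
qed

section \<open>The Lagrangian of a joined graph\<close>

definition joined :: "nat \<Rightarrow> nat \<Rightarrow> nat set set \<Rightarrow> nat set set" where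
  "joined n r H = ksets {1..n} r \<union> insert (n + 1) ` ksets {1..n} (r - 1)
     \<union> insert (n + 2) ` ksets {1..n} (r - 1) \<union> (\<lambda>B. insert (n + 1) (insert (n + 2) B)) ` H"

text \<open>The weight of a joined graph when the vertices \<open>n + 1\<close> and \<open>n + 2\<close> share the weight \<open>y\<close> equally,
  which is the optimal way to share it.\<close>

definition Phi :: "nat \<Rightarrow> nat \<Rightarrow> nat set set \<Rightarrow> (nat \<Rightarrow> real) \<Rightarrow> real \<Rightarrow> real" where
  "Phi n r H w y = esym {1..n} r w + y * esym {1..n} (r - 1) w + y\<^sup>2 / 4 * weight w H"

definition admissible :: "nat \<Rightarrow> (nat \<Rightarrow> real) \<Rightarrow> real \<Rightarrow> bool" where
  "admissible n w y \<longleftrightarrow> (\<forall>i\<in>{1..n}. 0 \<le> w i) \<and> 0 \<le> y \<and> sum w {1..n} + y = 1"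

lemma sum_joined:
  fixes F :: "nat set \<Rightarrow> 'a::comm_monoid_add"
  assumes H: "H \<subseteq> ksets {1..n} q"
  shows "sum F (joined n r H) = sum F (ksets {1..n} r)
     + (\<Sum>S\<in>ksets {1..n} (r - 1). F (insert (n + 1) S))
     + (\<Sum>S\<in>ksets {1..n} (r - 1). F (insert (n + 2) S))
     + (\<Sum>S\<in>H. F (insert (n + 1) (insert (n + 2) S)))"
proof -
  have fH: "finite H" using finite_subset[OF H] by simp
  let ?A = "ksets {1..n} r" and ?B = "insert (n + 1) ` ksets {1..n} (r - 1)"
    and ?C = "insert (n + 2) ` ksets {1..n} (r - 1)" and ?D = "(\<lambda>B. insert (n + 1) (insert (n + 2) B)) ` H"
  have not_in: "n + 1 \<notin> S" "n + 2 \<notin> S" if "S \<in> ksets {1..n} k" for S k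
    using that by (auto simp: ksets_def)
  have notA: "n + 1 \<notin> S" "n + 2 \<notin> S" if "S \<in> ?A" for S using not_in that by auto
  have notB: "n + 1 \<in> S" "n + 2 \<notin> S" if "S \<in> ?B" for S using not_in that by auto
  have notC: "n + 1 \<notin> S" "n + 2 \<in> S" if "S \<in> ?C" for S using not_in that by auto
  have notD: "n + 1 \<in> S" "n + 2 \<in> S" if "S \<in> ?D" for S using that by auto
  have "?A \<inter> ?B = {}" using notA notB by blast
  moreover have "(?A \<union> ?B) \<inter> ?C = {}" using notA notB notC by blast
  moreover have "(?A \<union> ?B \<union> ?C) \<inter> ?D = {}" using notA notB notC notD by blast
  ultimately have "sum F (joined n r H) = sum F ?A + sum F ?B + sum F ?C + sum F ?D"
    unfolding joined_def using fH by (simp add: sum.union_disjoint)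
  moreover have "inj_on (insert (n + 1)) (ksets {1..n} (r - 1))"
    using not_in(1) by (metis (no_types, lifting) inj_onI insert_ident)
  moreover have "inj_on (insert (n + 2)) (ksets {1..n} (r - 1))"
    using not_in(2) by (metis (no_types, lifting) inj_onI insert_ident)
  moreover have "inj_on (\<lambda>B. insert (n + 1) (insert (n + 2) B)) H"
  proof (rule inj_onI)
    fix S T assume "S \<in> H" "T \<in> H" and eq: "insert (n + 1) (insert (n + 2) S) = insert (n + 1) (insert (n + 2) T)"
    then have "n + 1 \<notin> S" "n + 2 \<notin> S" "n + 1 \<notin> T" "n + 2 \<notin> T" using H not_in by blast+
    then have "S = insert (n + 1) (insert (n + 2) S) - {n + 1, n + 2}"
      "T = insert (n + 1) (insert (n + 2) T) - {n + 1, n + 2}" by auto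
    then show "S = T" using eq by argo
  qed
  ultimately show ?thesis by (simp add: sum.reindex)
qed

lemma weight_joined:
  assumes H: "H \<subseteq> ksets {1..n} q"
  shows "weight w (joined n r H) = esym {1..n} r w + (w (n + 1) + w (n + 2)) * esym {1..n} (r - 1) w
           + w (n + 1) * w (n + 2) * weight w H"
proof -
  have fin: "finite S" "n + 1 \<notin> S" "n + 2 \<notin> S" if "S \<in> ksets {1..n} k" for S k
    using that by (auto simp: ksets_def dest: finite_subset)
  have p1: "(\<Sum>S\<in>ksets {1..n} k. prod w (insert (n + 1) S)) = w (n + 1) * (\<Sum>S\<in>ksets {1..n} k. prod w S)" for k
    unfolding sum_distrib_left by (rule sum.cong[OF refl], rule prod.insert[OF fin(1,2)])
  have p2: "(\<Sum>S\<in>ksets {1..n} k. prod w (insert (n + 2) S)) = w (n + 2) * (\<Sum>S\<in>ksets {1..n} k. prod w S)" for k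
    unfolding sum_distrib_left by (rule sum.cong[OF refl], rule prod.insert[OF fin(1,3)])
  have p3: "(\<Sum>S\<in>H. prod w (insert (n + 1) (insert (n + 2) S))) = w (n + 1) * w (n + 2) * (\<Sum>S\<in>H. prod w S)"
    unfolding sum_distrib_left
  proof (rule sum.cong[OF refl])
    fix S assume "S \<in> H"
    then have "S \<in> ksets {1..n} q" using H by blast
    from fin[OF this] show "prod w (insert (n + 1) (insert (n + 2) S)) = w (n + 1) * w (n + 2) * prod w S"
      by simp
  qed
  show ?thesis
    unfolding weight_def sum_joined[OF H] p1 p2 p3 by (simp add: distrib_right)
qed

lemma weight_joined_eq_Phi:
  assumes H: "H \<subseteq> ksets {1..n} q" and z: "\<And>i. i \<in> {1..n} \<Longrightarrow> z i = w i"
    and y: "z (n + 1) = y / 2" "z (n + 2) = y / 2"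
  shows "weight z (joined n r H) = Phi n r H w y"
proof -
  have "weight z H = weight w H"
    by (rule weight_cong, rule z, rule ksets_mem[OF subsetD[OF H]])
  moreover have "esym {1..n} k z = esym {1..n} k w" for k
    by (rule esym_cong, rule z)
  ultimately show ?thesis
    unfolding weight_joined[OF H] Phi_def y by (simp add: power2_eq_square)
qed

lemma card_joined:
  assumes H: "H \<subseteq> ksets {1..n} q"
  shows "card (joined n r H) = (n choose r) + 2 * (n choose (r - 1)) + card H"
  using sum_joined[OF H, of "\<lambda>_. 1::nat"] by (simp add: card_ksets)

lemma joined_subset:
  assumes H: "H \<subseteq> ksets {1..n} (r - 2)" and r: "2 \<le> r"
  shows "joined n r H \<subseteq> ksets {1..n + 2} r"
proof -
  have fin: "finite S" "n + 1 \<notin> S" "n + 2 \<notin> S" "S \<subseteq> {1..n}" "card S = k" if "S \<in> ksets {1..n} k" for S k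
    using that by (auto simp: ksets_def dest: finite_subset)
  have "insert (n + 1) S \<in> ksets {1..n + 2} r" "insert (n + 2) S \<in> ksets {1..n + 2} r"
    if "S \<in> ksets {1..n} (r - 1)" for S
    using fin[OF that] r by (force simp: ksets_def)+
  moreover have "insert (n + 1) (insert (n + 2) S) \<in> ksets {1..n + 2} r" if "S \<in> H" for S
  proof -
    have S: "S \<in> ksets {1..n} (r - 2)" using that H by blast
    have "card (insert (n + 1) (insert (n + 2) S)) = r" using fin[OF S] r by simp
    then show ?thesis using fin(4)[OF S] by (auto simp: ksets_def)
  qed
  moreover have "ksets {1..n} r \<subseteq> ksets {1..n + 2} r" by (auto simp: ksets_def)
  ultimately show ?thesis unfolding joined_def by auto
qed

lemma r_graph_joined:
  assumes "H \<subseteq> ksets {1..n} (r - 2)" "2 \<le> r"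
  shows "r_graph r (joined n r H)"
proof -
  have "finite (joined n r H)" using finite_subset[OF joined_subset[OF assms]] by simp
  moreover have "e \<subseteq> {1..} \<and> finite e \<and> card e = r" if "e \<in> joined n r H" for e
  proof -
    have "e \<subseteq> {1..n + 2}" "card e = r" using that joined_subset[OF assms] by (auto simp: ksets_def)
    then show ?thesis using finite_subset by auto
  qed
  ultimately show ?thesis unfolding r_graph_def by blast
qed

section \<open>Bounds for the supremum defining the Lagrangian\<close>

lemma weighting_le_1:
  assumes "weighting w" "finite A"
  shows "sum w A \<le> 1"
  using assms sum_le_suminf[of w A] unfolding weighting_def by (auto simp: sums_iff)

lemma weight_le_card:
  assumes w: "weighting w"
  shows "weight w G \<le> real (card G)"
proof -
  have "weight w G \<le> (\<Sum>e\<in>G. 1)"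
    unfolding weight_def
  proof (rule sum_mono)
    fix e
    have "w x \<le> 1" for x using weighting_le_1[OF w, of "{x}"] by simp
    then show "(\<Prod>x\<in>e. w x) \<le> 1" using w by (intro prod_le_1) (auto simp: weighting_def)
  qed
  then show ?thesis by simp
qed

lemma weight_le_lagrangian:
  assumes "weighting w"
  shows "weight w G \<le> lagrangian G"
  unfolding lagrangian_def
  by (rule cSup_upper) (use assms weight_le_card in \<open>auto intro!: bdd_aboveI[of _ "real (card G)"]\<close>)

lemma lagrangian_le:
  assumes "\<And>w. weighting w \<Longrightarrow> weight w G \<le> B"
  shows "lagrangian G \<le> B"
  unfolding lagrangian_def
proof (rule cSup_least)
  have "(\<lambda>i. if i = 1 then 1 else 0 :: real) sums 1"
    using sums_single[of 1 "\<lambda>_. 1 :: real"] by simp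
  then have "weighting (\<lambda>i. if i = 1 then 1 else 0)" unfolding weighting_def by auto
  then show "{weight w G |w. weighting w} \<noteq> {}" by blast
qed (use assms in auto)

lemma Phi_le_lagrangian:
  assumes H: "H \<subseteq> ksets {1..n} q" and w: "admissible n w y"
  shows "Phi n r H w y \<le> lagrangian (joined n r H)"
proof -
  define z where "z i = (if i \<in> {1..n} then w i else if i \<in> {n + 1, n + 2} then y / 2 else 0)" for i
  have "z sums (\<Sum>i\<in>{1..n} \<union> {n + 1, n + 2}. z i)"
    by (rule sums_finite) (auto simp: z_def)
  also have "(\<Sum>i\<in>{1..n} \<union> {n + 1, n + 2}. z i) = sum z {1..n} + z (n + 1) + z (n + 2)"
    by (subst sum.union_disjoint) auto
  also have "sum z {1..n} = sum w {1..n}" by (simp add: z_def)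
  also have "sum w {1..n} + z (n + 1) + z (n + 2) = 1"
    using w by (simp add: z_def admissible_def)
  finally have "z sums 1" .
  moreover have "0 \<le> z i" "z 0 = 0" for i using w by (auto simp: z_def admissible_def)
  ultimately have "weighting z" unfolding weighting_def by blast
  then have "weight z (joined n r H) \<le> lagrangian (joined n r H)" by (rule weight_le_lagrangian)
  moreover have "weight z (joined n r H) = Phi n r H w y"
    by (rule weight_joined_eq_Phi[OF H]) (auto simp: z_def)
  ultimately show ?thesis by simp
qed

text \<open>All weight outside {1..n} may be moved to n + 1 and n + 2 and divided equally: vertices
  beyond n + 2 lie in no edge, and a product of nonnegative numbers with given sum is largest for
  equal factors.\<close>

lemma lagrangian_joined_le:
  assumes H: "H \<subseteq> ksets {1..n} q" and B: "\<And>w y. admissible n w y \<Longrightarrow> Phi n r H w y \<le> B"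
  shows "lagrangian (joined n r H) \<le> B"
proof (rule lagrangian_le)
  fix w assume w: "weighting w"
  then have nn: "0 \<le> w i" for i by (simp add: weighting_def)
  define y where "y = 1 - sum w {1..n}"
  have "sum w ({1..n} \<union> {n + 1, n + 2}) \<le> 1" by (rule weighting_le_1[OF w]) simp
  moreover have "sum w ({1..n} \<union> {n + 1, n + 2}) = sum w {1..n} + (w (n + 1) + w (n + 2))"
    by (subst sum.union_disjoint) auto
  ultimately have y: "w (n + 1) + w (n + 2) \<le> y" unfolding y_def by simp
  have "w (n + 1) * w (n + 2) \<le> (w (n + 1) + w (n + 2))\<^sup>2 / 4"
    using sum_squares_bound[of "w (n + 1)" "w (n + 2)"] by (simp add: power2_sum)
  also have "\<dots> \<le> y\<^sup>2 / 4" using y nn by (intro divide_right_mono power_mono) auto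
  finally have y2: "w (n + 1) * w (n + 2) \<le> y\<^sup>2 / 4" .
  have "weight w (joined n r H) \<le> Phi n r H w y"
    unfolding weight_joined[OF H] Phi_def using y y2 nn
    by (intro add_mono mult_right_mono weight_nonneg) auto
  also have "\<dots> \<le> B"
  proof (rule B)
    have "0 \<le> y" using nn[of "n + 1"] nn[of "n + 2"] y by linarith
    then show "admissible n w y" using nn by (simp add: admissible_def y_def)
  qed
  finally show "weight w (joined n r H) \<le> B" .
qed

section \<open>Lagrangian values of complete graphs and the a priori bound\<close>

lemma binomial_over_power:
  assumes "n > 0"
  shows "fact r * (real (n choose r) / real n ^ r) = (\<Prod>i<r. 1 - real i / real n)"
proof -
  have "fact r * real (n choose r) = (\<Prod>i<r. real n - real i)"
    by (simp add: binomial_gbinomial gbinomial_mult_fact atLeast0LessThan)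
  then have "fact r * (real (n choose r) / real n ^ r) = (\<Prod>i<r. real n - real i) / (\<Prod>i<r. real n)"
    by simp
  also have "\<dots> = (\<Prod>i<r. (real n - real i) / real n)"
    by (rule prod_dividef[symmetric])
  also have "\<dots> = (\<Prod>i<r. 1 - real i / real n)"
    using assms by (intro prod.cong) (auto simp: diff_divide_distrib)
  finally show ?thesis .
qed

text \<open>Makes the cut-off \<open>y0\<close> in \<open>lagrangian_joined_less\<close> positive.
  The factor i = 0 is constantly 1, so strict growth is read off at i = 1, which occurs because 2
  \<le> r.\<close>

lemma binomial_over_power_strict_mono:
  assumes "2 \<le> r" "r \<le> n"
  shows "real (n choose r) / real n ^ r < real (Suc n choose r) / real (Suc n) ^ r"
proof -
  have "(\<Prod>i<r. 1 - real i / real n) < (\<Prod>i<r. 1 - real i / real (Suc n))"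
  proof (rule prod_mono_strict[of 1])
    show "1 - real 1 / real n < 1 - real 1 / real (Suc n)" using assms by (simp add: field_simps)
  qed (use assms in \<open>auto simp: field_simps\<close>)
  then have "fact r * (real (n choose r) / real n ^ r) < fact r * (real (Suc n choose r) / real (Suc n) ^ r)"
    using assms by (simp only: binomial_over_power)
  then show ?thesis by (simp only: mult_less_cancel_left_pos fact_gt_zero)
qed

text \<open>Corresponding factors of the two products differ by O(1/n^2) and lie between 1/2 and 1,
  so the products differ by at most the sum of these differences. The lower bound 2^(-r) turns the
  absolute difference into a relative one.\<close>

lemma binomial_over_power_diff:
  assumes n: "2 * r \<le> n" "0 < n"
  shows "real ((n + 2) choose r) / real (n + 2) ^ r * (1 - 2 ^ r * (2 * real r * real r) / (real n)\<^sup>2)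
    \<le> real (n choose r) / real n ^ r"
proof -
  define f where "f m = (\<Prod>i<r. 1 - real i / real m)" for m
  define c where "c = 2 * real r * real r / (real n)\<^sup>2"
  have half: "1 / 2 \<le> 1 - real i / real m" "1 - real i / real m \<le> 1" if "i < r" "n \<le> m" for i m
    using that n by (auto simp: field_simps)
  have "f (n + 2) - f n \<le> norm (f (n + 2) - f n)" by simp
  also have "\<dots> \<le> (\<Sum>i<r. norm ((1 - real i / real (n + 2)) - (1 - real i / real n)))"
    unfolding f_def
  proof (rule norm_prod_diff)
    fix i assume "i \<in> {..<r}"
    then show "norm (1 - real i / real (n + 2)) \<le> 1" "norm (1 - real i / real n) \<le> 1"
      using half[of i n] half[of i "n + 2"] unfolding real_norm_def lessThan_iff by linarith+
  qed
  also have "\<dots> \<le> (\<Sum>i<r. 2 * real r / (real n)\<^sup>2)"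
  proof (rule sum_mono)
    fix i assume i: "i \<in> {..<r}"
    have n0: "real n > 0" using n by simp
    have "(1 - real i / real (n + 2)) - (1 - real i / real n) = 2 * real i / (real n * (real n + 2))"
      using n0 by (simp add: field_simps)
    moreover have "2 * real i / (real n * (real n + 2)) \<le> 2 * real r / (real n)\<^sup>2"
      using i n0 by (intro frac_le) (auto simp: power2_eq_square)
    moreover have "0 \<le> 2 * real i / (real n * (real n + 2))" using n0 by simp
    ultimately show "norm ((1 - real i / real (n + 2)) - (1 - real i / real n)) \<le> 2 * real r / (real n)\<^sup>2"
      by simp
  qed
  also have "\<dots> = c" by (simp add: c_def)
  finally have d: "f (n + 2) - f n \<le> c" .
  have "(1 / 2) ^ r = (\<Prod>i<r. 1 / 2 :: real)" by simp
  also have "\<dots> \<le> f (n + 2)" unfolding f_def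
    by (intro prod_mono) (use half[of _ "n + 2"] in auto)
  finally have "1 \<le> 2 ^ r * f (n + 2)" by (simp add: field_simps)
  then have "c * 1 \<le> c * (2 ^ r * f (n + 2))"
    by (intro mult_left_mono) (auto simp: c_def)
  then have "f (n + 2) * (1 - 2 ^ r * c) \<le> f n" using d by (simp add: algebra_simps)
  then have "fact r * (real ((n + 2) choose r) / real (n + 2) ^ r) * (1 - 2 ^ r * c)
      \<le> fact r * (real (n choose r) / real n ^ r)"
    using n unfolding f_def by (simp only: binomial_over_power add_gr_0 zero_less_numeral simp_thms)
  then have "fact r * (real ((n + 2) choose r) / real (n + 2) ^ r * (1 - 2 ^ r * c))
      \<le> fact r * (real (n choose r) / real n ^ r)" by (simp only: mult.assoc)
  then have "real ((n + 2) choose r) / real (n + 2) ^ r * (1 - 2 ^ r * c) \<le> real (n choose r) / real n ^ r"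
    by (simp only: mult_le_cancel_left_pos fact_gt_zero)
  then show ?thesis by (simp add: c_def)
qed

text \<open>Compare with the complete graph on \<open>n + 2\<close> vertices: its Lagrangian exceeds that of the complete
  graph on \<open>n\<close> vertices only by a factor \<open>1 + O(1/n\<^sup>2)\<close>, so near-optimal weights have variance \<open>O(1/n\<^sup>2)\<close>.\<close>

lemma a_priori:
  assumes r: "2 \<le> r"
  shows "\<exists>K>0. \<forall>n H w y. 2 * r \<le> n \<longrightarrow> H \<subseteq> ksets {1..n} (r - 2) \<longrightarrow> admissible n w y \<longrightarrow>
    real (n choose r) / real n ^ r < Phi n r H w y \<longrightarrow> y \<le> K / real n \<and> (\<forall>i\<in>{1..n}. w i \<le> K / real n)"
proof -
  \<comment> \<open>The constant of \<open>binomial_over_power_diff\<close>. It will bound the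
    variance by K1 / n^2 and each single deviation by its root; the factor 2 in the witness is there
    because \<open>y\<close> is the weight of two vertices.\<close>
  define K1 where "K1 = 2 ^ r * (2 * real r * real r)"
  have K1: "K1 > 0" using r by (simp add: K1_def)
  show ?thesis
  proof (intro exI[of _ "2 * (1 + sqrt K1)"] conjI allI impI ballI)
    show "0 < 2 * (1 + sqrt K1)" using K1 by (simp add: add_pos_pos)
    fix n H w y
    assume n: "2 * r \<le> n" and H: "H \<subseteq> ksets {1..n} (r - 2)" and w: "admissible n w y"
      and big: "real (n choose r) / real n ^ r < Phi n r H w y"
    define N where "N = n + 2"
    define z where "z i = (if i \<in> {1..n} then w i else y / 2)" for i
    have n0: "0 < n" using n r by simp
    have z0: "0 \<le> z i" if "i \<in> {1..N}" for i
      using w by (auto simp: z_def admissible_def)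
    have "{1..N} = {1..n} \<union> {n + 1, n + 2}" unfolding N_def by auto
    then have "sum z {1..N} = sum z {1..n} + (z (n + 1) + z (n + 2))"
      by (simp add: sum.union_disjoint)
    then have z1: "sum z {1..N} = 1"
      using w by (simp add: z_def admissible_def)
    define g where "g i = real N * z i" for i
    have "weight z (joined n r H) \<le> esym {1..N} r z"
    proof (rule weight_mono_graph)
      show "joined n r H \<subseteq> ksets {1..N} r" unfolding N_def by (rule joined_subset[OF H r])
      show "0 \<le> z x" if "e \<in> ksets {1..N} r" "x \<in> e" for e x
        by (rule z0, rule ksets_mem[OF that])
    qed simp
    moreover have "weight z (joined n r H) = Phi n r H w y"
      by (rule weight_joined_eq_Phi[OF H]) (auto simp: z_def)
    ultimately have "Phi n r H w y \<le> esym {1..N} r z" by simp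
    also have "\<dots> = esym {1..N} r (\<lambda>i. (1 / real N) * g i)"
      by (rule esym_cong) (simp add: g_def N_def)
    also have "\<dots> = (1 / real N) ^ r * esym {1..N} r g"
      by (rule weight_scale) (auto dest: ksetsD)
    also have "\<dots> \<le> (1 / real N) ^ r * ((1 - (\<Sum>i\<in>{1..N}. (g i - 1)\<^sup>2) / (real N)\<^sup>2) * real (N choose r))"
    proof (rule mult_left_mono)
      show "esym {1..N} r g \<le> (1 - (\<Sum>i\<in>{1..N}. (g i - 1)\<^sup>2) / (real N)\<^sup>2) * real (N choose r)"
        using esym_le_variance[of "{1..N}" g r] z0 z1 r
        by (simp add: g_def sum_distrib_left[symmetric] N_def)
    qed simp
    also have "(\<Sum>i\<in>{1..N}. (g i - 1)\<^sup>2) / (real N)\<^sup>2 = (\<Sum>i\<in>{1..N}. (z i - 1 / real N)\<^sup>2)"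
      unfolding sum_divide_distrib
      by (intro sum.cong refl) (simp add: g_def N_def power2_eq_square field_simps)
    finally have up: "Phi n r H w y \<le> real (N choose r) / real N ^ r * (1 - (\<Sum>i\<in>{1..N}. (z i - 1 / real N)\<^sup>2))"
      by (simp add: power_one_over field_simps)
    have "real (N choose r) / real N ^ r * (1 - K1 / (real n)\<^sup>2) \<le> real (n choose r) / real n ^ r"
      using binomial_over_power_diff[OF n n0] by (simp add: N_def K1_def)
    also have "\<dots> < real (N choose r) / real N ^ r * (1 - (\<Sum>i\<in>{1..N}. (z i - 1 / real N)\<^sup>2))"
      using big up by linarith
    finally have "1 - K1 / (real n)\<^sup>2 < 1 - (\<Sum>i\<in>{1..N}. (z i - 1 / real N)\<^sup>2)"
      by (rule mult_left_less_imp_less) simp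
    then have S2: "(\<Sum>i\<in>{1..N}. (z i - 1 / real N)\<^sup>2) \<le> K1 / (real n)\<^sup>2" by simp
    have z: "z i \<le> (1 + sqrt K1) / real n" if "i \<in> {1..N}" for i
    proof -
      have "(z i - 1 / real N)\<^sup>2 \<le> (\<Sum>i\<in>{1..N}. (z i - 1 / real N)\<^sup>2)"
        by (rule member_le_sum[OF that]) auto
      then have "z i - 1 / real N \<le> sqrt (K1 / (real n)\<^sup>2)"
        using S2 by (intro real_le_rsqrt) linarith
      moreover have "sqrt (K1 / (real n)\<^sup>2) = sqrt K1 / real n"
        by (simp add: real_sqrt_divide)
      moreover have "1 / real N \<le> 1 / real n" using n0 by (simp add: N_def frac_le)
      ultimately show ?thesis by (simp add: add_divide_distrib)
    qed
    show "y \<le> 2 * (1 + sqrt K1) / real n"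
      using z[of "n + 1"] by (simp add: z_def N_def field_simps)
    fix i assume i: "i \<in> {1..n}"
    then have "w i \<le> (1 + sqrt K1) / real n" using z[of i] by (simp add: z_def N_def)
    also have "\<dots> \<le> 2 * (1 + sqrt K1) / real n"
      using K1 by (intro divide_right_mono) auto
    finally show "w i \<le> 2 * (1 + sqrt K1) / real n" .
  qed
qed

section \<open>Second-order estimates\<close>

definition mean_weight :: "nat \<Rightarrow> real \<Rightarrow> real" where
  "mean_weight n y = (1 - y) / real n"

definition base :: "nat \<Rightarrow> nat \<Rightarrow> real \<Rightarrow> real" where
  "base n r y = real (n choose r) * mean_weight n y ^ r
     + y * (real (n choose (r - 1)) * mean_weight n y ^ (r - 1))"

text \<open>With weights \<open>mean_weight n y * (1 + u i)\<close> and \<open>\<Sum>u i = 0\<close>, the value of \<open>Phi\<close> is approximately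
  \<open>base + slope * (card H + \<Sum>d(i) u(i)) - curv * \<Sum>u(i)\<^sup>2\<close>.\<close>

definition slope :: "nat \<Rightarrow> nat \<Rightarrow> real \<Rightarrow> real" where
  "slope n r y = y\<^sup>2 / 4 * mean_weight n y ^ (r - 2)"

definition curv :: "nat \<Rightarrow> nat \<Rightarrow> real \<Rightarrow> real" where
  "curv n r y = (real ((n - 2) choose (r - 2)) * mean_weight n y ^ r
     + y * (real ((n - 2) choose (r - 3)) * mean_weight n y ^ (r - 1))) / 2"

lemma Phi_mean_weight:
  assumes H: "H \<subseteq> ksets {1..n} (r - 2)"
  shows "Phi n r H (\<lambda>i. mean_weight n y * g i) y = mean_weight n y ^ r * esym {1..n} r g
     + y * (mean_weight n y ^ (r - 1) * esym {1..n} (r - 1) g) + slope n r y * weight g H"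
proof -
  have "weight (\<lambda>i. mean_weight n y * g i) H = mean_weight n y ^ (r - 2) * weight g H"
    by (rule weight_scale) (use H in \<open>auto dest: ksetsD\<close>)
  moreover have "esym {1..n} k (\<lambda>i. mean_weight n y * g i) = mean_weight n y ^ k * esym {1..n} k g" for k
    by (rule weight_scale) (auto dest: ksetsD)
  ultimately show ?thesis unfolding Phi_def slope_def by simp
qed

text \<open>Since n - 2 \<ge> n / 2, powers of n and binomial coefficients of n - 2 agree up to a
  constant. Errors arise as powers of n and have to be measured against \<open>curv\<close>, which
  is built from binomial coefficients.\<close>

lemma power_le_binomial:
  assumes "2 \<le> r" "2 * r \<le> n" "j \<le> r - 2"
  shows "real n ^ j \<le> (2 * real r) ^ r * real ((n - 2) choose j)"
proof (cases "j = 0")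
  case True
  have "1 \<le> (2 * real r) ^ r" using assms by (intro one_le_power) auto
  then show ?thesis using True by simp
next
  case False
  have "(real n / 2 / real j) ^ j \<le> (real (n - 2) / real j) ^ j"
    using assms by (intro power_mono divide_right_mono) (auto simp: of_nat_diff)
  also have "\<dots> \<le> real ((n - 2) choose j)"
    using assms by (intro binomial_ge_n_over_k_pow_k) auto
  finally have "real n ^ j / (2 * real j) ^ j \<le> real ((n - 2) choose j)"
    by (simp add: power_divide)
  then have "real n ^ j \<le> (2 * real j) ^ j * real ((n - 2) choose j)"
    using False by (simp add: pos_divide_le_eq mult.commute)
  also have "\<dots> \<le> (2 * real r) ^ r * real ((n - 2) choose j)"
  proof (rule mult_right_mono)
    have "(2 * real j) ^ j \<le> (2 * real r) ^ j" using assms by (intro power_mono) auto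
    also have "\<dots> \<le> (2 * real r) ^ r" using assms by (intro power_increasing) auto
    finally show "(2 * real j) ^ j \<le> (2 * real r) ^ r" .
  qed simp
  finally show ?thesis .
qed

context
  fixes r n :: nat and y Y :: real
  assumes r: "4 \<le> r" and n: "2 * r \<le> n" and y: "0 \<le> y" "y \<le> 1 / 2" "real n * y \<le> Y"
begin

lemma mean_weight_ge: "1 / (2 * real n) \<le> mean_weight n y" "0 < mean_weight n y"
  "mean_weight n y \<le> 1 / real n"
proof -
  have "0 < real n" using r n by simp
  then show "1 / (2 * real n) \<le> mean_weight n y" "0 < mean_weight n y" "mean_weight n y \<le> 1 / real n"
    using y unfolding mean_weight_def by (auto simp: field_simps)
qed

lemma curv_pos: "0 < curv n r y"
proof -
  have "0 < real ((n - 2) choose (r - 2)) * mean_weight n y ^ r"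
    using mean_weight_ge r n by (intro mult_pos_pos) auto
  moreover have "0 \<le> y * (real ((n - 2) choose (r - 3)) * mean_weight n y ^ (r - 1))"
    using mean_weight_ge y by auto
  ultimately show ?thesis unfolding curv_def by simp
qed

lemma slope_nonneg: "0 \<le> slope n r y"
  unfolding slope_def using mean_weight_ge by auto

text \<open>Since n x \<ge> 1/2 for the mean weight x, the bound n y \<le> Y gives y \<le> 2 x Y. So
  \<open>slope\<close> is at most of order x^r, while \<open>curv\<close> is at least of order
  n^(r-2) x^r. The optimal weights thus respond to one unit of degree by O(n^(-(r-2))), and this is
  why card H must stay below a small multiple of n^(r-2).\<close>

lemma slope_le_curv: "slope n r y * real n ^ (r - 2) \<le> 2 * Y\<^sup>2 * (2 * real r) ^ r * curv n r y"
proof -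
  define x where "x = mean_weight n y"
  have x: "0 < x" "1 \<le> 2 * real n * x"
    using mean_weight_ge r n unfolding x_def by (auto simp: field_simps)
  have Y: "0 \<le> Y" using y(1,3) by (meson mult_nonneg_nonneg of_nat_0_le_iff order_trans)
  have "y \<le> y * (2 * real n * x)" using x y by (simp add: mult_le_cancel_left1)
  also have "\<dots> = 2 * x * (real n * y)" by simp
  also have "\<dots> \<le> 2 * x * Y" using x y by (intro mult_left_mono) auto
  finally have "y\<^sup>2 \<le> (2 * x * Y)\<^sup>2" using y by (intro power_mono) auto
  then have "slope n r y \<le> Y\<^sup>2 * x\<^sup>2 * x ^ (r - 2)"
    unfolding slope_def x_def[symmetric] using x by (intro mult_right_mono) (auto simp: power_mult_distrib mult_ac)
  also have "\<dots> = Y\<^sup>2 * x ^ (2 + (r - 2))" by (simp only: mult.assoc power_add)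
  also have "2 + (r - 2) = r" using r by simp
  finally have "slope n r y * real n ^ (r - 2) \<le> Y\<^sup>2 * x ^ r * ((2 * real r) ^ r * real ((n - 2) choose (r - 2)))"
    using power_le_binomial[of r n "r - 2"] r n x by (intro mult_mono) auto
  also have "\<dots> = Y\<^sup>2 * (2 * real r) ^ r * (real ((n - 2) choose (r - 2)) * x ^ r)" by simp
  also have "\<dots> \<le> Y\<^sup>2 * (2 * real r) ^ r * (2 * curv n r y)"
    using x y Y by (intro mult_left_mono) (auto simp: curv_def x_def)
  finally show ?thesis by simp
qed

text \<open>Rests on k (k-1) C(n,k) = n (n-1) C(n-2,k-2). It converts the proportional loss U / n^2
  of \<open>base\<close> that \<open>esym_le_variance\<close> provides into a loss of
  \<open>curv\<close> times U, up to the factor r^2.\<close>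

lemma base_ge_curv: "(real n)\<^sup>2 * curv n r y \<le> (real r)\<^sup>2 * base n r y"
proof -
  define x where "x = mean_weight n y"
  have x: "0 < x" using mean_weight_ge unfolding x_def by auto
  have C: "(real n)\<^sup>2 * real ((n - 2) choose (k - 2)) \<le> 2 * (real r)\<^sup>2 * real (n choose k)"
    if "2 \<le> k" "k \<le> r" for k
  proof -
    have 1: "k * (n choose k) = n * ((n - 1) choose (k - 1))"
      using that by (intro times_binomial_minus1_eq) auto
    have "(k - 1) * ((n - 1) choose (k - 1)) = (n - 1) * ((n - 1 - 1) choose (k - 1 - 1))"
      using that by (intro times_binomial_minus1_eq) auto
    then have "(k - 1) * ((n - 1) choose (k - 1)) = (n - 1) * ((n - 2) choose (k - 2))"
      by (simp add: numeral_2_eq_2)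
    with 1 have "(k - 1) * k * (n choose k) = n * (n - 1) * ((n - 2) choose (k - 2))"
      by (metis mult.assoc mult.left_commute)
    then have eq: "real (k - 1) * real k * real (n choose k) = real n * real (n - 1) * real ((n - 2) choose (k - 2))"
      by (metis of_nat_mult)
    have "(real n)\<^sup>2 \<le> 2 * (real n * real (n - 1))"
      using n r by (simp add: power2_eq_square of_nat_diff)
    then have "(real n)\<^sup>2 * real ((n - 2) choose (k - 2)) \<le> 2 * (real n * real (n - 1)) * real ((n - 2) choose (k - 2))"
      by (intro mult_right_mono) auto
    also have "\<dots> = 2 * (real (k - 1) * real k) * real (n choose k)" using eq by simp
    also have "\<dots> \<le> 2 * (real r * real r) * real (n choose k)"
      using that by (intro mult_right_mono mult_left_mono mult_mono) auto
    finally show ?thesis by (simp add: power2_eq_square)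
  qed
  have "(real n)\<^sup>2 * (2 * curv n r y)
      = ((real n)\<^sup>2 * real ((n - 2) choose (r - 2))) * x ^ r + y * (((real n)\<^sup>2 * real ((n - 2) choose (r - 1 - 2))) * x ^ (r - 1))"
    unfolding curv_def x_def by (simp add: algebra_simps numeral_3_eq_3 numeral_2_eq_2)
  also have "\<dots> \<le> (2 * (real r)\<^sup>2 * real (n choose r)) * x ^ r + y * ((2 * (real r)\<^sup>2 * real (n choose (r - 1))) * x ^ (r - 1))"
    using r x y by (intro add_mono mult_right_mono mult_left_mono C) auto
  also have "\<dots> = 2 * (real r)\<^sup>2 * base n r y"
    unfolding base_def x_def[symmetric] by (simp add: algebra_simps)
  finally show ?thesis by simp
qed

end

text \<open>The two symmetric sums are expanded by \<open>esym_local\<close>, the weight of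
  \<open>H\<close> by \<open>weight_one_plus_approx\<close>. What matters is the shape of the error:
  a multiple of the quadratic term itself, small as soon as the total deviation and 1/n are.\<close>

lemma Phi_local:
  assumes r: "4 \<le> r" and Y: "0 < Y"
  obtains K where "0 < K" "\<And>n y u H. 2 * r \<le> n \<Longrightarrow> 0 \<le> y \<Longrightarrow> y \<le> 1 / 2 \<Longrightarrow> real n * y \<le> Y \<Longrightarrow>
    sum u {1..n} = 0 \<Longrightarrow> (\<Sum>i\<in>{1..n}. \<bar>u i\<bar>) \<le> 1 \<Longrightarrow> H \<subseteq> ksets {1..n} (r - 2) \<Longrightarrow>
    \<bar>Phi n r H (\<lambda>i. mean_weight n y * (1 + u i)) y - (base n r y + slope n r y * real (card H)
       + slope n r y * (\<Sum>i\<in>{1..n}. real (deg H i) * u i) - curv n r y * (\<Sum>i\<in>{1..n}. (u i)\<^sup>2))\<bar>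
    \<le> K * ((\<Sum>i\<in>{1..n}. \<bar>u i\<bar>) + 1 / real n) * curv n r y * (\<Sum>i\<in>{1..n}. (u i)\<^sup>2)"
proof -
  obtain K1 where K1: "0 \<le> K1" and W: "\<And>A H u. finite A \<Longrightarrow> H \<subseteq> ksets A (r - 2) \<Longrightarrow> (\<forall>i\<in>A. \<bar>u i\<bar> \<le> 1) \<Longrightarrow>
    \<bar>weight (\<lambda>i. 1 + u i) H - real (card H) - (\<Sum>i\<in>A. real (deg H i) * u i)\<bar>
      \<le> K1 * real (card A) ^ (r - 2 - 1) * (\<Sum>i\<in>A. (u i)\<^sup>2)"
    using weight_one_plus_approx[of 1 "r - 2"] r by force
  define c where "c = (2 * real r) ^ r"
  have c: "0 < c" using r by (simp add: c_def)
  define K where "K = 2 * real r * c + 2 * Y\<^sup>2 * c * K1"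
  have K0: "0 < 2 * real r * c" "0 \<le> 2 * Y\<^sup>2 * c * K1" using c r K1 by auto
  show thesis
  proof (rule that[of K])
    show "0 < K" unfolding K_def using K0 by linarith
    fix n y and u :: "nat \<Rightarrow> real" and H
    assume n: "2 * r \<le> n" and y: "0 \<le> y" "y \<le> 1 / 2" "real n * y \<le> Y" and u0: "sum u {1..n} = 0"
      and u1: "(\<Sum>i\<in>{1..n}. \<bar>u i\<bar>) \<le> 1" and H: "H \<subseteq> ksets {1..n} (r - 2)"
    define x where "x = mean_weight n y"
    define U where "U = (\<Sum>i\<in>{1..n}. (u i)\<^sup>2)"
    define s where "s = (\<Sum>i\<in>{1..n}. \<bar>u i\<bar>)"
    define A where "A = curv n r y"
    define b where "b = slope n r y"
    define L where "L = (\<Sum>i\<in>{1..n}. real (deg H i) * u i)"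
    have x: "0 < x" unfolding x_def using mean_weight_ge[OF r n y] by simp
    have U: "0 \<le> U" and s: "0 \<le> s" unfolding U_def s_def by (auto intro: sum_nonneg)
    have n0: "0 < n" using n r by simp
    have ui: "\<forall>i\<in>{1..n}. \<bar>u i\<bar> \<le> 1"
    proof
      fix i assume "i \<in> {1..n}"
      then have "\<bar>u i\<bar> \<le> (\<Sum>i\<in>{1..n}. \<bar>u i\<bar>)" by (intro member_le_sum) auto
      then show "\<bar>u i\<bar> \<le> 1" using u1 by linarith
    qed
    have E: "\<bar>esym {1..n} k (\<lambda>i. 1 + u i) - (real (n choose k) - real ((n - 2) choose (k - 2)) * U / 2)\<bar>
        \<le> real r * c * real ((n - 2) choose (k - 2)) * s * U" if k: "3 \<le> k" "k \<le> r" for k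
    proof -
      have "\<bar>esym {1..n} k (\<lambda>i. 1 + u i) - (real (n choose k) - real ((n - 2) choose (k - 2)) * U / 2)\<bar>
          \<le> real k * real n ^ (k - 2) * s * U"
        using esym_local[of "{1..n}" u k] n0 k u0 u1 unfolding U_def s_def by simp
      also have "\<dots> \<le> real r * (c * real ((n - 2) choose (k - 2))) * s * U"
        using power_le_binomial[of r n "k - 2"] r n k U s c
        by (intro mult_right_mono mult_mono) (auto simp: c_def)
      finally show ?thesis by (simp add: mult.assoc)
    qed
    define e1 where "e1 = esym {1..n} r (\<lambda>i. 1 + u i) - (real (n choose r) - real ((n - 2) choose (r - 2)) * U / 2)"
    define e2 where "e2 = esym {1..n} (r - 1) (\<lambda>i. 1 + u i) - (real (n choose (r - 1)) - real ((n - 2) choose (r - 3)) * U / 2)"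
    define e3 where "e3 = weight (\<lambda>i. 1 + u i) H - real (card H) - L"
    have "r - 1 - 2 = r - 3" by simp
    then have e2: "\<bar>e2\<bar> \<le> real r * c * real ((n - 2) choose (r - 3)) * s * U"
      using E[of "r - 1"] r unfolding e2_def by simp
    have e1: "\<bar>e1\<bar> \<le> real r * c * real ((n - 2) choose (r - 2)) * s * U"
      using E[of r] r unfolding e1_def by simp
    have e3: "\<bar>e3\<bar> \<le> K1 * real n ^ (r - 3) * U"
      using W[of "{1..n}" H u] H ui unfolding e3_def L_def U_def by (simp add: numeral_3_eq_3 numeral_2_eq_2)
    have "Phi n r H (\<lambda>i. x * (1 + u i)) y - (base n r y + b * real (card H) + b * L - A * U)
        = x ^ r * e1 + y * (x ^ (r - 1) * e2) + b * e3"
      unfolding x_def Phi_mean_weight[OF H] base_def b_def e1_def e2_def e3_def A_def curv_def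
      by (simp add: algebra_simps add_divide_distrib)
    also have "\<bar>\<dots>\<bar> \<le> x ^ r * \<bar>e1\<bar> + y * (x ^ (r - 1) * \<bar>e2\<bar>) + b * \<bar>e3\<bar>"
      using x y slope_nonneg[OF r n y] unfolding b_def
      by (intro order_trans[OF abs_triangle_ineq] add_mono) (auto simp: abs_mult)
    also have "\<dots> \<le> x ^ r * (real r * c * real ((n - 2) choose (r - 2)) * s * U)
         + y * (x ^ (r - 1) * (real r * c * real ((n - 2) choose (r - 3)) * s * U)) + b * (K1 * real n ^ (r - 3) * U)"
      using x y slope_nonneg[OF r n y] e1 e2 e3 unfolding b_def
      by (intro add_mono mult_left_mono) auto
    also have "\<dots> = 2 * real r * c * s * A * U + K1 * (b * real n ^ (r - 3)) * U"
      unfolding A_def curv_def x_def by (simp add: algebra_simps)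
    also have "\<dots> \<le> 2 * real r * c * s * A * U + K1 * (2 * Y\<^sup>2 * c * A / real n) * U"
    proof -
      have "r - 2 = Suc (r - 3)" using r by simp
      then have "b * real n ^ (r - 3) * real n = b * real n ^ (r - 2)" by simp
      also have "\<dots> \<le> 2 * Y\<^sup>2 * c * A" unfolding b_def A_def c_def by (rule slope_le_curv[OF r n y])
      finally have "b * real n ^ (r - 3) \<le> 2 * Y\<^sup>2 * c * A / real n"
        using n0 by (simp add: pos_le_divide_eq)
      then show ?thesis using K1 U by (intro add_left_mono mult_right_mono mult_left_mono) auto
    qed
    also have "\<dots> \<le> K * (s + 1 / real n) * A * U"
    proof -
      have "0 \<le> 2 * real r * c * (1 / real n) * (A * U) + 2 * Y\<^sup>2 * c * K1 * s * (A * U)"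
        using c K1 s U curv_pos[OF r n y] unfolding A_def by (intro add_nonneg_nonneg mult_nonneg_nonneg) auto
      then show ?thesis unfolding K_def by (simp add: algebra_simps)
    qed
    finally show "\<bar>Phi n r H (\<lambda>i. mean_weight n y * (1 + u i)) y - (base n r y + slope n r y * real (card H)
       + slope n r y * (\<Sum>i\<in>{1..n}. real (deg H i) * u i) - curv n r y * (\<Sum>i\<in>{1..n}. (u i)\<^sup>2))\<bar>
      \<le> K * ((\<Sum>i\<in>{1..n}. \<bar>u i\<bar>) + 1 / real n) * curv n r y * (\<Sum>i\<in>{1..n}. (u i)\<^sup>2)"
      unfolding x_def b_def A_def L_def U_def s_def .
  qed
qed

section \<open>Optimising the second-order model from below and from above\<close>

definition degsq :: "nat \<Rightarrow> nat set set \<Rightarrow> real" where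
  "degsq n H = (\<Sum>i\<in>{1..n}. (real (deg H i))\<^sup>2)"

text \<open>The weighting is the critical point of the quadratic model: u i = \<theta> (d(i) - m)
  with \<open>m\<close> the mean degree, which keeps the total at 0, and \<theta> = slope / (2
  curv). Its value is slope^2 / (4 curv) times the centred degree-square sum; the error of
  \<open>Phi_local\<close> costs the factor 1 - \<epsilon>.\<close>

lemma Phi_lower:
  assumes r: "4 \<le> r" and Y: "0 < Y" and eps: "0 < \<epsilon>"
  shows "\<exists>\<rho>>0. \<exists>n0. \<forall>n\<ge>n0. \<forall>y H. 0 \<le> y \<longrightarrow> y \<le> 1 / 2 \<longrightarrow> real n * y \<le> Y \<longrightarrow>
    H \<subseteq> ksets {1..n} (r - 2) \<longrightarrow> real (card H) \<le> \<rho> * real n ^ (r - 2) \<longrightarrow>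
    (\<exists>w. admissible n w y \<and> base n r y + slope n r y * real (card H)
       + (slope n r y)\<^sup>2 / (4 * curv n r y) * ((1 - \<epsilon>) * (degsq n H - (real (r - 2) * real (card H))\<^sup>2 / real n))
      \<le> Phi n r H w y)"
proof -
  obtain K where K: "0 < K" and loc: "\<And>n y u H. 2 * r \<le> n \<Longrightarrow> 0 \<le> y \<Longrightarrow> y \<le> 1 / 2 \<Longrightarrow> real n * y \<le> Y \<Longrightarrow>
    sum u {1..n} = 0 \<Longrightarrow> (\<Sum>i\<in>{1..n}. \<bar>u i\<bar>) \<le> 1 \<Longrightarrow> H \<subseteq> ksets {1..n} (r - 2) \<Longrightarrow>
    \<bar>Phi n r H (\<lambda>i. mean_weight n y * (1 + u i)) y - (base n r y + slope n r y * real (card H)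
       + slope n r y * (\<Sum>i\<in>{1..n}. real (deg H i) * u i) - curv n r y * (\<Sum>i\<in>{1..n}. (u i)\<^sup>2))\<bar>
    \<le> K * ((\<Sum>i\<in>{1..n}. \<bar>u i\<bar>) + 1 / real n) * curv n r y * (\<Sum>i\<in>{1..n}. (u i)\<^sup>2)"
    by (rule Phi_local[OF r Y]) blast
  define c where "c = 2 * Y\<^sup>2 * (2 * real r) ^ r"
  define q where "q = real (r - 2)"
  have cq: "0 < c * q" using Y r by (simp add: c_def q_def)
  \<comment> \<open>The relative error, \<open>K\<close> times total deviation plus 1/n, has to be
    at most \<epsilon>: \<open>\<eta>\<close> takes care of one half and \<open>n0\<close> of the
    other. The cap 1 keeps the weights nonnegative and \<open>Phi_local\<close> applicable.\<close>
  define \<eta> where "\<eta> = min 1 (\<epsilon> / (2 * K))"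
  have \<eta>: "0 < \<eta>" "\<eta> \<le> 1" "K * \<eta> \<le> \<epsilon> / 2"
    using K eps by (auto simp: \<eta>_def min_def field_simps)
  define n0 where "n0 = max (2 * r) (nat \<lceil>2 * K / \<epsilon>\<rceil>)"
  show ?thesis
  proof (intro exI[of _ "\<eta> / (c * q)"] conjI exI[of _ n0] allI impI)
    show "0 < \<eta> / (c * q)" using \<eta> cq by simp
    fix n y H
    assume n0: "n0 \<le> n" and y: "0 \<le> y" "y \<le> 1 / 2" "real n * y \<le> Y"
      and H: "H \<subseteq> ksets {1..n} (r - 2)" and card: "real (card H) \<le> \<eta> / (c * q) * real n ^ (r - 2)"
    have n: "2 * r \<le> n" and nK: "2 * K / \<epsilon> \<le> real n" using n0 unfolding n0_def by linarith+
    have n1: "0 < real n" using n r by simp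
    have Kn: "K * (1 / real n) \<le> \<epsilon> / 2" using nK n1 eps by (simp add: field_simps)
    define s where "s = real (card H)"
    define b where "b = slope n r y"
    define A where "A = curv n r y"
    define m where "m = q * s / real n"
    define W where "W = degsq n H - (q * s)\<^sup>2 / real n"
    define \<theta> where "\<theta> = b / (2 * A)"
    define u where "u i = \<theta> * (real (deg H i) - m)" for i
    have A: "0 < A" unfolding A_def by (rule curv_pos[OF r n y])
    have b: "0 \<le> b" unfolding b_def by (rule slope_nonneg[OF r n y])
    have sd: "(\<Sum>i\<in>{1..n}. real (deg H i)) = q * s"
      using sum_deg_eq[OF _ H] by (simp add: q_def s_def)
    have nm: "real n * m = q * s" using n1 by (simp add: m_def)
    have u0: "sum u {1..n} = 0"
      unfolding u_def sum_distrib_left[symmetric] by (simp add: sum_subtractf sd[simplified] nm)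
    have th: "0 \<le> \<theta>" using A b by (simp add: \<theta>_def)
    have m0: "0 \<le> m" by (simp add: m_def q_def s_def)
    \<comment> \<open>The total deviation is at most \<theta> times twice the degree sum q s, hence
      O(s / n^(r-2)). The density bound \<eta> / (c q) is read off from this.\<close>
    have "(\<Sum>i\<in>{1..n}. \<bar>u i\<bar>) \<le> (\<Sum>i\<in>{1..n}. \<theta> * (real (deg H i) + m))"
      unfolding u_def abs_mult using th m0 by (intro sum_mono mult_mono) auto
    also have "\<dots> = \<theta> * (2 * (q * s))"
      unfolding sum_distrib_left[symmetric] by (simp add: sum.distrib sd[simplified] nm)
    also have "\<dots> = b / A * (q * s)" by (simp add: \<theta>_def)
    also have "\<dots> \<le> c / real n ^ (r - 2) * (q * s)"
    proof (rule mult_right_mono)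
      have "b * real n ^ (r - 2) \<le> c * A"
        unfolding b_def c_def A_def by (rule slope_le_curv[OF r n y])
      then show "b / A \<le> c / real n ^ (r - 2)" using A n1 by (simp add: field_simps)
    qed (simp add: q_def s_def)
    also have "\<dots> = c * q * s / real n ^ (r - 2)" by simp
    also have "\<dots> \<le> \<eta>"
      using card cq n1 unfolding s_def by (simp add: field_simps)
    finally have us: "(\<Sum>i\<in>{1..n}. \<bar>u i\<bar>) \<le> \<eta>" .
    have sq: "(\<Sum>i\<in>{1..n}. real (deg H i) * (real (deg H i) - m)) = W"
    proof -
      have "(\<Sum>i\<in>{1..n}. real (deg H i) * (real (deg H i) - m)) = degsq n H - (\<Sum>i\<in>{1..n}. real (deg H i)) * m"
        unfolding degsq_def by (simp add: algebra_simps sum_subtractf power2_eq_square sum_distrib_left)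
      then show ?thesis unfolding sd W_def m_def by (simp add: power2_eq_square)
    qed
    have du: "(\<Sum>i\<in>{1..n}. real (deg H i) * u i) = \<theta> * W"
      unfolding sq[symmetric] u_def sum_distrib_left by (simp add: mult_ac)
    have "(\<Sum>i\<in>{1..n}. (u i)\<^sup>2) = \<theta> * (\<Sum>i\<in>{1..n}. real (deg H i) * u i) - \<theta> * m * sum u {1..n}"
      unfolding sum_distrib_left sum_subtractf[symmetric] u_def
      by (intro sum.cong) (auto simp: power2_eq_square algebra_simps)
    then have uu: "(\<Sum>i\<in>{1..n}. (u i)\<^sup>2) = \<theta>\<^sup>2 * W" unfolding du u0 by (simp add: power2_eq_square)
    then have W: "0 \<le> \<theta>\<^sup>2 * W" by (metis sum_nonneg zero_le_power2)
    have "\<bar>Phi n r H (\<lambda>i. mean_weight n y * (1 + u i)) y - (base n r y + b * s + b * (\<theta> * W) - A * (\<theta>\<^sup>2 * W))\<bar>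
      \<le> K * ((\<Sum>i\<in>{1..n}. \<bar>u i\<bar>) + 1 / real n) * A * (\<theta>\<^sup>2 * W)"
      using loc[OF n y u0 order_trans[OF us \<eta>(2)] H] unfolding du uu b_def A_def s_def .
    also have "\<dots> \<le> \<epsilon> * A * (\<theta>\<^sup>2 * W)"
    proof (intro mult_right_mono)
      have "K * (\<Sum>i\<in>{1..n}. \<bar>u i\<bar>) \<le> K * \<eta>" using us K by (intro mult_left_mono) auto
      then show "K * ((\<Sum>i\<in>{1..n}. \<bar>u i\<bar>) + 1 / real n) \<le> \<epsilon>"
        using \<eta>(3) Kn unfolding distrib_left by linarith
    qed (use A W in auto)
    finally have "base n r y + b * s + b * (\<theta> * W) - A * (\<theta>\<^sup>2 * W) - \<epsilon> * A * (\<theta>\<^sup>2 * W)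
        \<le> Phi n r H (\<lambda>i. mean_weight n y * (1 + u i)) y" by linarith
    moreover have "b * (\<theta> * W) - A * (\<theta>\<^sup>2 * W) - \<epsilon> * A * (\<theta>\<^sup>2 * W) = b\<^sup>2 / (4 * A) * ((1 - \<epsilon>) * W)"
      using A by (simp add: \<theta>_def field_simps power2_eq_square)
    ultimately have "base n r y + b * s + b\<^sup>2 / (4 * A) * ((1 - \<epsilon>) * W)
        \<le> Phi n r H (\<lambda>i. mean_weight n y * (1 + u i)) y" by linarith
    moreover have "admissible n (\<lambda>i. mean_weight n y * (1 + u i)) y"
      unfolding admissible_def
    proof (intro conjI ballI)
      fix i assume i: "i \<in> {1..n}"
      have "\<bar>u i\<bar> \<le> (\<Sum>i\<in>{1..n}. \<bar>u i\<bar>)" by (rule member_le_sum[OF i]) auto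
      then have "0 \<le> 1 + u i" using us \<eta>(2) by linarith
      then show "0 \<le> mean_weight n y * (1 + u i)" using mean_weight_ge(2)[OF r n y] by simp
    next
      show "(\<Sum>i\<in>{1..n}. mean_weight n y * (1 + u i)) + y = 1"
        unfolding sum_distrib_left[symmetric] sum.distrib u0 using n1 by (simp add: mean_weight_def)
    qed (rule y)
    ultimately show "\<exists>w. admissible n w y \<and> base n r y + slope n r y * real (card H)
       + (slope n r y)\<^sup>2 / (4 * curv n r y) * ((1 - \<epsilon>) * (degsq n H - (real (r - 2) * real (card H))\<^sup>2 / real n))
      \<le> Phi n r H w y"
      unfolding b_def A_def s_def W_def q_def by blast
  qed
qed

lemma linear_minus_quadratic_le:
  fixes a c u :: real
  assumes "0 < c"
  shows "a * u - c * u\<^sup>2 \<le> a\<^sup>2 / (4 * c)"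
proof -
  have "0 \<le> (a - 2 * c * u)\<^sup>2 / (4 * c)" using assms by simp
  also have "\<dots> = a\<^sup>2 / (4 * c) - a * u + c * u\<^sup>2"
    using assms by (simp add: power2_eq_square field_simps)
  finally show ?thesis by linarith
qed

text \<open>The Maclaurin-type bound \<open>esym_le_variance\<close> has a non-optimal constant, but it forces
  \<open>\<Sum>|u i|\<close> to be small, after which the sharp local estimate applies.\<close>

lemma Phi_upper:
  assumes r: "4 \<le> r" and Y: "0 < Y" and eps: "0 < \<epsilon>" "\<epsilon> < 1"
  shows "\<exists>\<rho>>0. \<exists>n0. \<forall>n\<ge>n0. \<forall>w y H. admissible n w y \<longrightarrow> real n * y \<le> Y \<longrightarrow> (\<forall>i\<in>{1..n}. real n * w i \<le> Y) \<longrightarrow>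
    H \<subseteq> ksets {1..n} (r - 2) \<longrightarrow> real (card H) \<le> \<rho> * real n ^ (r - 2) \<longrightarrow>
    Phi n r H w y \<le> base n r y + slope n r y * real (card H)
       + (slope n r y)\<^sup>2 / (4 * curv n r y) * (degsq n H / (1 - \<epsilon>))"
proof -
  obtain K where K: "0 < K" and loc: "\<And>n y u H. 2 * r \<le> n \<Longrightarrow> 0 \<le> y \<Longrightarrow> y \<le> 1 / 2 \<Longrightarrow> real n * y \<le> Y \<Longrightarrow>
    sum u {1..n} = 0 \<Longrightarrow> (\<Sum>i\<in>{1..n}. \<bar>u i\<bar>) \<le> 1 \<Longrightarrow> H \<subseteq> ksets {1..n} (r - 2) \<Longrightarrow>
    \<bar>Phi n r H (\<lambda>i. mean_weight n y * (1 + u i)) y - (base n r y + slope n r y * real (card H)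
       + slope n r y * (\<Sum>i\<in>{1..n}. real (deg H i) * u i) - curv n r y * (\<Sum>i\<in>{1..n}. (u i)\<^sup>2))\<bar>
    \<le> K * ((\<Sum>i\<in>{1..n}. \<bar>u i\<bar>) + 1 / real n) * curv n r y * (\<Sum>i\<in>{1..n}. (u i)\<^sup>2)"
    by (rule Phi_local[OF r Y]) blast
  \<comment> \<open>Weights up to Y / n against a mean of at least 1 / (2 n) leave relative
    deviations up to 1 + 2 Y, bounded but not small.\<close>
  obtain K1 where K1: "0 \<le> K1" and W: "\<And>A H u. finite A \<Longrightarrow> H \<subseteq> ksets A (r - 2) \<Longrightarrow> (\<forall>i\<in>A. \<bar>u i\<bar> \<le> 1 + 2 * Y) \<Longrightarrow>
    \<bar>weight (\<lambda>i. 1 + u i) H - real (card H) - (\<Sum>i\<in>A. real (deg H i) * u i)\<bar>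
      \<le> K1 * real (card A) ^ (r - 2 - 1) * (\<Sum>i\<in>A. (u i)\<^sup>2)"
    using weight_one_plus_approx[of "1 + 2 * Y" "r - 2"] r Y by force
  define R where "R = (real r)\<^sup>2"
  have R: "0 < R" using r by (simp add: R_def)
  define c where "c = 2 * Y\<^sup>2 * (2 * real r) ^ r"
  define q where "q = real (r - 2)"
  have c: "0 < c" and q: "0 < q" using Y r by (simp_all add: c_def q_def)
  \<comment> \<open>Collects the constants of the chain ending in n U n^(r-2) \<le> K3 s; the
    density bound \<eta>^2 / K3 then gives n U \<le> \<eta>^2, and Cauchy-Schwarz a total deviation
    of at most \<eta>.\<close>
  define K3 where "K3 = 4 * R\<^sup>2 * c\<^sup>2 * q"
  have K3: "0 < K3" using R c q by (simp add: K3_def)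
  define \<eta> where "\<eta> = min 1 (\<epsilon> / (2 * K))"
  have \<eta>: "0 < \<eta>" "\<eta> \<le> 1" "K * \<eta> \<le> \<epsilon> / 2"
    using K eps by (auto simp: \<eta>_def min_def field_simps)
  define n0 where "n0 = max (max (2 * r) (nat \<lceil>2 * Y\<rceil>)) (max (nat \<lceil>2 * K / \<epsilon>\<rceil>) (nat \<lceil>2 * K1 * c * R\<rceil>))"
  show ?thesis
  proof (intro exI[of _ "\<eta>\<^sup>2 / K3"] conjI exI[of _ n0] allI impI)
    show "0 < \<eta>\<^sup>2 / K3" using \<eta> K3 by simp
    fix n w y H
    assume n0: "n0 \<le> n" and adm: "admissible n w y" and yY: "real n * y \<le> Y"
      and wY: "\<forall>i\<in>{1..n}. real n * w i \<le> Y"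
      and H: "H \<subseteq> ksets {1..n} (r - 2)" and card: "real (card H) \<le> \<eta>\<^sup>2 / K3 * real n ^ (r - 2)"
    have n: "2 * r \<le> n" and nY: "2 * Y \<le> real n" and nK: "2 * K / \<epsilon> \<le> real n"
      and nK1: "2 * K1 * c * R \<le> real n"
      using n0 unfolding n0_def by linarith+
    have n1: "0 < real n" using n r by simp
    have Kn: "K * (1 / real n) \<le> \<epsilon> / 2" using nK n1 eps by (simp add: field_simps)
    have w0: "\<And>i. i \<in> {1..n} \<Longrightarrow> 0 \<le> w i" and y0: "0 \<le> y" and sw: "sum w {1..n} + y = 1"
      using adm unfolding admissible_def by auto
    have "real n * y \<le> real n * (1 / 2)" using yY nY by linarith
    then have y2: "y \<le> 1 / 2" using n1 by (simp add: mult_le_cancel_left_pos)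
    note y = y0 y2 yY
    define x where "x = mean_weight n y"
    define s where "s = real (card H)"
    define b where "b = slope n r y"
    define A where "A = curv n r y"
    define u where "u i = w i / x - 1" for i
    define U where "U = (\<Sum>i\<in>{1..n}. (u i)\<^sup>2)"
    define L where "L = (\<Sum>i\<in>{1..n}. real (deg H i) * u i)"
    define B where "B = base n r y"
    have x: "0 < x" "1 / (2 * real n) \<le> x" unfolding x_def using mean_weight_ge[OF r n y] by auto
    have A: "0 < A" unfolding A_def by (rule curv_pos[OF r n y])
    have b: "0 \<le> b" unfolding b_def by (rule slope_nonneg[OF r n y])
    have bA: "b * real n ^ (r - 2) \<le> c * A"
      unfolding b_def c_def A_def by (rule slope_le_curv[OF r n y])
    have U0: "0 \<le> U" unfolding U_def by (intro sum_nonneg) auto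
    have w: "w = (\<lambda>i. x * (1 + u i))" using x by (auto simp: u_def)
    have "sum w {1..n} = x * real n" using sw n1 by (simp add: x_def mean_weight_def)
    then have u0: "sum u {1..n} = 0"
      unfolding u_def sum_subtractf sum_divide_distrib[symmetric] using x by simp
    have ui: "\<forall>i\<in>{1..n}. \<bar>u i\<bar> \<le> 1 + 2 * Y"
    proof
      fix i assume i: "i \<in> {1..n}"
      have "w i * 1 \<le> w i * (2 * real n * x)"
        using w0[OF i] x n1 by (intro mult_left_mono) (auto simp: field_simps)
      also have "\<dots> = 2 * x * (real n * w i)" by simp
      also have "\<dots> \<le> 2 * x * Y" using x wY i by (intro mult_left_mono) auto
      finally have "w i / x \<le> 2 * Y" using x by (simp add: field_simps)
      moreover have "0 \<le> w i / x" using x w0[OF i] by simp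
      ultimately show "\<bar>u i\<bar> \<le> 1 + 2 * Y" unfolding u_def by linarith
    qed
    have Phi: "Phi n r H w y = x ^ r * esym {1..n} r (\<lambda>i. 1 + u i)
       + y * (x ^ (r - 1) * esym {1..n} (r - 1) (\<lambda>i. 1 + u i)) + b * weight (\<lambda>i. 1 + u i) H"
      unfolding w x_def b_def by (rule Phi_mean_weight[OF H])
    have E: "esym {1..n} k (\<lambda>i. 1 + u i) \<le> (1 - U / (real n)\<^sup>2) * real (n choose k)" if "2 \<le> k" for k
    proof -
      have "0 \<le> 1 + u i" if "i \<in> {1..n}" for i using w0[OF that] x by (simp add: u_def)
      moreover have "(\<Sum>i\<in>{1..n}. 1 + u i) = real n" unfolding sum.distrib u0 by simp
      ultimately show ?thesis
        using esym_le_variance[of "{1..n}" "\<lambda>i. 1 + u i" k] that n r unfolding U_def by simp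
    qed
    have "Phi n r H w y \<le> x ^ r * ((1 - U / (real n)\<^sup>2) * real (n choose r))
       + y * (x ^ (r - 1) * ((1 - U / (real n)\<^sup>2) * real (n choose (r - 1)))) + b * weight (\<lambda>i. 1 + u i) H"
      unfolding Phi using x y r by (intro add_right_mono add_mono mult_left_mono E) auto
    also have "\<dots> = (1 - U / (real n)\<^sup>2) * B + b * weight (\<lambda>i. 1 + u i) H"
      unfolding B_def base_def x_def by (simp add: algebra_simps)
    also have "\<dots> \<le> (1 - U / (real n)\<^sup>2) * B + b * (s + L + K1 * real n ^ (r - 3) * U)"
    proof (intro add_left_mono mult_left_mono b)
      have "\<bar>weight (\<lambda>i. 1 + u i) H - s - L\<bar> \<le> K1 * real n ^ (r - 3) * U"
        using W[of "{1..n}" H u] H ui unfolding L_def U_def s_def by (simp add: numeral_3_eq_3 numeral_2_eq_2)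
      then show "weight (\<lambda>i. 1 + u i) H \<le> s + L + K1 * real n ^ (r - 3) * U" by linarith
    qed
    finally have crude: "Phi n r H w y \<le> B + b * s + b * L - U / (real n)\<^sup>2 * B + K1 * (b * real n ^ (r - 3)) * U"
      by (simp add: algebra_simps)
    \<comment> \<open>The crude bound loses at least A / R times U. The error coming from
      \<open>H\<close> is O(A / n) times U and consumes at most half of this beyond
      \<open>n0\<close>.\<close>
    have "A / R \<le> B / (real n)\<^sup>2"
      using base_ge_curv[OF r n y] R n1 unfolding A_def R_def B_def by (simp add: field_simps)
    then have "A / R * U \<le> B / (real n)\<^sup>2 * U" using U0 by (intro mult_right_mono)
    moreover have "K1 * (b * real n ^ (r - 3)) * U \<le> A / (2 * R) * U"
    proof (rule mult_right_mono[OF _ U0])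
      have "r - 2 = Suc (r - 3)" using r by simp
      then have "b * real n ^ (r - 3) * real n \<le> c * A" using bA by (simp add: mult_ac)
      then have "2 * R * K1 * (b * real n ^ (r - 3) * real n) \<le> 2 * R * K1 * (c * A)"
        using K1 R by (intro mult_left_mono) auto
      also have "\<dots> = 2 * K1 * c * R * A" by simp
      also have "\<dots> \<le> real n * A" using nK1 A by (intro mult_right_mono) auto
      finally have "2 * R * K1 * (b * real n ^ (r - 3) * real n) \<le> real n * A" .
      then have "real n * (2 * R * (K1 * (b * real n ^ (r - 3)))) \<le> real n * A" by (simp add: mult_ac)
      then have "2 * R * (K1 * (b * real n ^ (r - 3))) \<le> A" using n1 by (simp add: mult_le_cancel_left_pos)
      then show "K1 * (b * real n ^ (r - 3)) \<le> A / (2 * R)" using R by (simp add: field_simps)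
    qed
    ultimately have crude2: "Phi n r H w y \<le> B + b * s + b * L - A / (2 * R) * U"
      using crude by (simp add: field_simps)
    show "Phi n r H w y \<le> base n r y + slope n r y * real (card H)
       + (slope n r y)\<^sup>2 / (4 * curv n r y) * (degsq n H / (1 - \<epsilon>))"
    \<comment> \<open>If the deviation gains nothing, the claim is immediate. Otherwise the linear
      gain b L outweighs the crude quadratic loss, and that limits U.\<close>
    proof (cases "Phi n r H w y \<le> B + b * s")
      case True
      have "0 \<le> b\<^sup>2 / (4 * A) * (degsq n H / (1 - \<epsilon>))"
        using A eps by (auto simp: degsq_def intro!: mult_nonneg_nonneg divide_nonneg_nonneg sum_nonneg)
      then show ?thesis using True unfolding B_def b_def A_def s_def by linarith
    next
      case False
      then have "A / (2 * R) * U \<le> b * L" using crude2 by linarith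
      \<comment> \<open>Half of the quadratic loss is spent on the linear term; the other half then
        bounds U by a multiple of the degree-square sum.\<close>
      moreover have "b * L - A / (4 * R) * U \<le> (R / A) * b\<^sup>2 * degsq n H"
      proof -
        have "b * L - A / (4 * R) * U = (\<Sum>i\<in>{1..n}. (b * real (deg H i)) * u i - A / (4 * R) * (u i)\<^sup>2)"
          unfolding L_def U_def by (simp add: sum_subtractf sum_distrib_left mult.assoc)
        also have "\<dots> \<le> (\<Sum>i\<in>{1..n}. (b * real (deg H i))\<^sup>2 / (4 * (A / (4 * R))))"
          using A R by (intro sum_mono linear_minus_quadratic_le) auto
        also have "\<dots> = (R / A) * b\<^sup>2 * degsq n H"
          unfolding degsq_def sum_distrib_left using A R by (intro sum.cong) (auto simp: power_mult_distrib field_simps)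
        finally show ?thesis .
      qed
      ultimately have "A / (4 * R) * U \<le> (R / A) * b\<^sup>2 * degsq n H" by (simp add: field_simps)
      then have "A\<^sup>2 * U \<le> 4 * R\<^sup>2 * b\<^sup>2 * degsq n H"
        using A R by (simp add: field_simps power2_eq_square)
      also have "\<dots> \<le> 4 * R\<^sup>2 * b\<^sup>2 * (real n ^ (r - 3) * (q * s))"
      proof (rule mult_left_mono)
        have "degsq n H \<le> real n ^ (r - 2 - 1) * (q * s)"
          using sum_deg_square_le[OF _ H] r unfolding degsq_def q_def s_def by simp
        then show "degsq n H \<le> real n ^ (r - 3) * (q * s)" by (simp add: numeral_3_eq_3 numeral_2_eq_2)
      qed simp
      finally have "A\<^sup>2 * U * (real n * real n ^ (r - 2)) \<le> 4 * R\<^sup>2 * b\<^sup>2 * (real n ^ (r - 3) * (q * s)) * (real n * real n ^ (r - 2))"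
        using n1 by (intro mult_right_mono) auto
      also have "\<dots> = 4 * R\<^sup>2 * (b * real n ^ (r - 2))\<^sup>2 * (q * s)"
      proof -
        have "r - 2 = Suc (r - 3)" using r by simp
        then have "real n ^ (r - 2) = real n * real n ^ (r - 3)" by simp
        then show ?thesis by (simp add: power2_eq_square mult_ac)
      qed
      also have "\<dots> \<le> 4 * R\<^sup>2 * (c * A)\<^sup>2 * (q * s)"
        using bA b n1 q by (intro mult_right_mono mult_left_mono power_mono) (auto simp: s_def)
      also have "\<dots> = A\<^sup>2 * (K3 * s)" by (simp add: K3_def power_mult_distrib)
      finally have "A\<^sup>2 * (U * (real n * real n ^ (r - 2))) \<le> A\<^sup>2 * (K3 * s)" by (simp add: mult.assoc)
      then have "U * (real n * real n ^ (r - 2)) \<le> K3 * s" using A by (simp add: mult_le_cancel_left_pos)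
      also have "\<dots> \<le> \<eta>\<^sup>2 * real n ^ (r - 2)" using card K3 unfolding s_def by (simp add: field_simps)
      finally have "(real n * U) * real n ^ (r - 2) \<le> \<eta>\<^sup>2 * real n ^ (r - 2)" by (simp add: mult_ac)
      then have nU: "real n * U \<le> \<eta>\<^sup>2" using n1 by (simp add: mult_le_cancel_right_pos)
      have "(\<Sum>i\<in>{1..n}. \<bar>u i\<bar>)\<^sup>2 \<le> real n * U"
        using sum_squared_le_sum_of_squares[of "\<lambda>i. \<bar>u i\<bar>" "{1..n}"] unfolding U_def by (simp add: mult.commute)
      then have us: "(\<Sum>i\<in>{1..n}. \<bar>u i\<bar>) \<le> \<eta>" using nU \<eta>(1) power2_le_imp_le order_trans less_imp_le by meson
      have "\<bar>Phi n r H w y - (B + b * s + b * L - A * U)\<bar>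
        \<le> K * ((\<Sum>i\<in>{1..n}. \<bar>u i\<bar>) + 1 / real n) * A * U"
        using loc[OF n y u0 order_trans[OF us \<eta>(2)] H]
        unfolding B_def b_def L_def s_def A_def U_def w x_def .
      also have "\<dots> \<le> \<epsilon> * A * U"
      proof (intro mult_right_mono)
        have "K * (\<Sum>i\<in>{1..n}. \<bar>u i\<bar>) \<le> K * \<eta>" using us K by (intro mult_left_mono) auto
        then show "K * ((\<Sum>i\<in>{1..n}. \<bar>u i\<bar>) + 1 / real n) \<le> \<epsilon>"
          using \<eta>(3) Kn unfolding distrib_left by linarith
      qed (use A U0 in auto)
      finally have "Phi n r H w y \<le> B + b * s + (b * L - ((1 - \<epsilon>) * A) * U)"
        by (simp add: algebra_simps abs_le_iff)
      \<comment> \<open>Each coordinate is maximised on its own, without regard to the zero total.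
        This yields the plain degree-square sum, whereas the lower bound carries the correction (q
        s)^2 / n.\<close>
      moreover have "b * L - ((1 - \<epsilon>) * A) * U \<le> b\<^sup>2 / (4 * A) * (degsq n H / (1 - \<epsilon>))"
      proof -
        have "b * L - ((1 - \<epsilon>) * A) * U = (\<Sum>i\<in>{1..n}. (b * real (deg H i)) * u i - ((1 - \<epsilon>) * A) * (u i)\<^sup>2)"
          unfolding L_def U_def by (simp add: sum_subtractf sum_distrib_left mult.assoc)
        also have "\<dots> \<le> (\<Sum>i\<in>{1..n}. (b * real (deg H i))\<^sup>2 / (4 * ((1 - \<epsilon>) * A)))"
          using A eps by (intro sum_mono linear_minus_quadratic_le) auto
        also have "\<dots> = b\<^sup>2 / (4 * A) * (degsq n H / (1 - \<epsilon>))"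
          unfolding degsq_def sum_distrib_left sum_divide_distrib by (intro sum.cong) (auto simp: power_mult_distrib)
        finally show ?thesis .
      qed
      ultimately show ?thesis unfolding B_def b_def A_def s_def by linarith
    qed
  qed
qed

section \<open>Comparison of Lagrangians by degree squares\<close>

lemma esym_const: "finite A \<Longrightarrow> esym A k (\<lambda>_. c) = real (card A choose k) * c ^ k"
  unfolding weight_def by (simp add: card_ksets ksetsD(2))

lemma esym_le_binomial_mean:
  assumes A: "finite A" and g: "\<And>i. i \<in> A \<Longrightarrow> 0 \<le> g i"
  shows "esym A k g \<le> real (card A choose k) * (sum g A / real (card A)) ^ k"
proof (cases "sum g A = 0")
  case True
  show ?thesis
  proof (cases "k = 0")
    case True
    then show ?thesis using A by (simp add: weight_def)
  next
    case False
    then show ?thesis using esym_le_power[OF A, of g k] g True by (simp add: power_0_left)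
  qed
next
  case False
  define x where "x = sum g A / real (card A)"
  have "0 < sum g A" using False sum_nonneg[of A g] g by force
  moreover have "card A \<noteq> 0" using False A by auto
  ultimately have x: "0 < x" unfolding x_def by simp
  have "esym A k g = esym A k (\<lambda>i. x * (g i / x))" using x by simp
  also have "\<dots> = x ^ k * esym A k (\<lambda>i. g i / x)" by (rule weight_scale) (auto dest: ksetsD)
  also have "\<dots> \<le> x ^ k * real (card A choose k)"
  proof (intro mult_left_mono esym_le_binomial A)
    show "(\<Sum>i\<in>A. g i / x) = real (card A)"
      unfolding sum_divide_distrib[symmetric] x_def using False \<open>card A \<noteq> 0\<close> by simp
  qed (use x g in auto)
  finally show ?thesis unfolding x_def by (simp add: mult.commute)
qed

text \<open>Edges meeting n + 1 or n + 2 contribute at most 2 y, and the others are bounded by the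
  complete graph on n vertices. This disposes of those \<open>y\<close> for which
  \<open>slope\<close> is too small to yield a uniform gap.\<close>

lemma Phi_le_small:
  assumes r: "2 \<le> r" and H: "H \<subseteq> ksets {1..n} (r - 2)" and adm: "admissible n w y"
  shows "Phi n r H w y \<le> real (n choose r) / real n ^ r + 2 * y"
proof -
  have w0: "\<And>i. i \<in> {1..n} \<Longrightarrow> 0 \<le> w i" and y0: "0 \<le> y" and sw: "sum w {1..n} + y = 1"
    using adm unfolding admissible_def by auto
  have s0: "0 \<le> sum w {1..n}" by (intro sum_nonneg w0)
  have y1: "y \<le> 1" and s1: "sum w {1..n} \<le> 1" using sw s0 y0 by linarith+
  have e1: "esym {1..n} k w \<le> 1" for k
    using esym_le_power[of "{1..n}" w k] w0 power_le_one[OF s0 s1, of k] by fastforce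
  have "esym {1..n} r w \<le> real (n choose r) * (sum w {1..n} / real n) ^ r"
    using esym_le_binomial_mean[of "{1..n}" w r] w0 by simp
  also have "\<dots> \<le> real (n choose r) * (1 / real n) ^ r"
    using s0 s1 by (intro mult_left_mono power_mono divide_right_mono) auto
  finally have a: "esym {1..n} r w \<le> real (n choose r) / real n ^ r" by (simp add: power_one_over)
  have b: "y * esym {1..n} (r - 1) w \<le> y" using e1[of "r - 1"] y0 by (simp add: mult_left_le)
  have "weight w H \<le> esym {1..n} (r - 2) w"
  proof (rule weight_mono_graph[OF _ H])
    show "0 \<le> w x" if "e \<in> ksets {1..n} (r - 2)" "x \<in> e" for e x
      by (rule w0, rule ksets_mem[OF that])
  qed simp
  then have "weight w H \<le> 1" using e1[of "r - 2"] by linarith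
  then have "y\<^sup>2 / 4 * weight w H \<le> y\<^sup>2 / 4 * 1" by (intro mult_left_mono) auto
  also have "\<dots> \<le> y" using y0 mult_left_mono[OF y1 y0] by (simp add: power2_eq_square)
  finally show ?thesis using a b unfolding Phi_def by linarith
qed

text \<open>Uniform weights on n + 1 vertices, the last weight being shared by n + 1 and n + 2: with
  the edges from \<open>H\<close> discarded these two act as a single vertex.\<close>

lemma lagrangian_joined_ge:
  assumes H: "H \<subseteq> ksets {1..n} (r - 2)" and r: "1 \<le> r"
  shows "real (Suc n choose r) / real (Suc n) ^ r \<le> lagrangian (joined n r H)"
proof -
  define x where "x = 1 / real (Suc n)"
  have x: "0 < x" unfolding x_def by simp
  have "admissible n (\<lambda>_. x) x"
    using x unfolding admissible_def x_def by (simp add: field_simps)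
  then have "Phi n r H (\<lambda>_. x) x \<le> lagrangian (joined n r H)" by (rule Phi_le_lagrangian[OF H])
  moreover obtain k where k: "r = Suc k" using r by (cases r) auto
  have "real (Suc n choose r) / real (Suc n) ^ r = real (n choose r) * x ^ r + x * (real (n choose (r - 1)) * x ^ (r - 1))"
    unfolding x_def k by (simp add: power_one_over add_divide_distrib del: of_nat_Suc)
  moreover have "0 \<le> x\<^sup>2 / 4 * weight (\<lambda>_. x) H" using x by (auto intro!: mult_nonneg_nonneg weight_nonneg)
  ultimately show ?thesis unfolding Phi_def by (simp add: esym_const)
qed

text \<open>Gives a lower bound for slope^2 / (4 curv) by slope^2 / 4, in which \<open>curv\<close>
  no longer depends on \<open>y\<close>.\<close>

lemma curv_le_1:
  assumes r: "4 \<le> r" and n: "2 * r \<le> n" and y: "0 \<le> y" "y \<le> 1 / 2" "real n * y \<le> Y"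
  shows "curv n r y \<le> 1"
proof -
  define x where "x = mean_weight n y"
  have x: "0 < x" "x \<le> 1 / real n" unfolding x_def using mean_weight_ge[OF r n y] by auto
  have n1: "1 \<le> real n" using n r by simp
  have C: "real ((n - 2) choose j) * x ^ k \<le> 1" if "j \<le> k" for j k
  proof -
    have "real ((n - 2) choose j) \<le> real (n - 2) ^ j" by (rule binomial_le_power)
    also have "\<dots> \<le> real n ^ j" by (intro power_mono) auto
    also have "\<dots> \<le> real n ^ k" using that n1 by (intro power_increasing) auto
    finally have "real ((n - 2) choose j) * x ^ k \<le> real n ^ k * (1 / real n) ^ k"
      using x by (intro mult_mono power_mono) auto
    also have "\<dots> = 1" using n1 by (simp add: power_one_over)
    finally show ?thesis .
  qed
  have "y * (real ((n - 2) choose (r - 3)) * x ^ (r - 1)) \<le> 1 * 1"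
    using y x by (intro mult_mono C) auto
  then show ?thesis using C[of "r - 2" r] unfolding curv_def x_def[symmetric] by simp
qed

text \<open>A Lagrangian is a supremum, so beating each single weighting is not enough: all
  weightings for \<open>C\<close> must stay below by a fixed \<open>gap\<close>. At a common
  \<open>y\<close> the terms \<open>base\<close> and \<open>slope\<close> times the edge number
  coincide for \<open>C\<close> and \<open>H\<close>, and the degree-square hypothesis separates
  what remains.\<close>

lemma lagrangian_joined_less:
  assumes r: "4 \<le> r" and eps: "0 < \<epsilon>" "\<epsilon> < 1"
  obtains \<rho> n0 where "0 < \<rho>" "\<And>n C H. n0 \<le> n \<Longrightarrow> C \<subseteq> ksets {1..n} (r - 2) \<Longrightarrow> H \<subseteq> ksets {1..n} (r - 2) \<Longrightarrow>
    card C = card H \<Longrightarrow> real (card H) \<le> \<rho> * real n ^ (r - 2) \<Longrightarrow>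
    degsq n C < (1 - \<epsilon>) * (degsq n H - (real (r - 2) * real (card H))\<^sup>2 / real n) \<Longrightarrow>
    lagrangian (joined n r C) < lagrangian (joined n r H)"
proof -
  have r2: "2 \<le> r" using r by simp
  obtain Y where Y: "0 < Y" and ap: "\<And>n H w y. 2 * r \<le> n \<Longrightarrow> H \<subseteq> ksets {1..n} (r - 2) \<Longrightarrow> admissible n w y \<Longrightarrow>
    real (n choose r) / real n ^ r < Phi n r H w y \<Longrightarrow> y \<le> Y / real n \<and> (\<forall>i\<in>{1..n}. w i \<le> Y / real n)"
    using a_priori[OF r2] by blast
  \<comment> \<open>Both second-order bounds lose a factor 1 - e, and (1 - e)^2 \<ge> 1 -
    \<epsilon>.\<close>
  define e where "e = \<epsilon> / 2"
  have e: "0 < e" "e < 1" using eps by (auto simp: e_def)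
  obtain \<rho>1 n1 where \<rho>1: "0 < \<rho>1" and low: "\<And>n y H. n1 \<le> n \<Longrightarrow> 0 \<le> y \<Longrightarrow> y \<le> 1 / 2 \<Longrightarrow> real n * y \<le> Y \<Longrightarrow>
    H \<subseteq> ksets {1..n} (r - 2) \<Longrightarrow> real (card H) \<le> \<rho>1 * real n ^ (r - 2) \<Longrightarrow>
    (\<exists>w. admissible n w y \<and> base n r y + slope n r y * real (card H)
       + (slope n r y)\<^sup>2 / (4 * curv n r y) * ((1 - e) * (degsq n H - (real (r - 2) * real (card H))\<^sup>2 / real n))
      \<le> Phi n r H w y)"
    using Phi_lower[OF r Y e(1)] by blast
  obtain \<rho>2 n2 where \<rho>2: "0 < \<rho>2" and up: "\<And>n w y H. n2 \<le> n \<Longrightarrow> admissible n w y \<Longrightarrow> real n * y \<le> Y \<Longrightarrow>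
    (\<forall>i\<in>{1..n}. real n * w i \<le> Y) \<Longrightarrow> H \<subseteq> ksets {1..n} (r - 2) \<Longrightarrow> real (card H) \<le> \<rho>2 * real n ^ (r - 2) \<Longrightarrow>
    Phi n r H w y \<le> base n r y + slope n r y * real (card H)
       + (slope n r y)\<^sup>2 / (4 * curv n r y) * (degsq n H / (1 - e))"
    using Phi_upper[OF r Y e] by blast
  show thesis
  proof (rule that[of "min \<rho>1 \<rho>2" "max (max n1 n2) (max (2 * r) (nat \<lceil>2 * Y\<rceil>))"])
    show "0 < min \<rho>1 \<rho>2" using \<rho>1 \<rho>2 by simp
    fix n C H
    assume n0: "max (max n1 n2) (max (2 * r) (nat \<lceil>2 * Y\<rceil>)) \<le> n"
      and C: "C \<subseteq> ksets {1..n} (r - 2)" and H: "H \<subseteq> ksets {1..n} (r - 2)" and cc: "card C = card H"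
      and card: "real (card H) \<le> min \<rho>1 \<rho>2 * real n ^ (r - 2)"
      and lt: "degsq n C < (1 - \<epsilon>) * (degsq n H - (real (r - 2) * real (card H))\<^sup>2 / real n)"
    have n: "n1 \<le> n" "n2 \<le> n" "2 * r \<le> n" "2 * Y \<le> real n" using n0 by linarith+
    have nn: "0 < real n" using n r by simp
    have min_le: "min \<rho>1 \<rho>2 * real n ^ (r - 2) \<le> \<rho>1 * real n ^ (r - 2)"
      "min \<rho>1 \<rho>2 * real n ^ (r - 2) \<le> \<rho>2 * real n ^ (r - 2)" by (intro mult_right_mono; simp)+
    have card1: "real (card H) \<le> \<rho>1 * real n ^ (r - 2)" and card2: "real (card C) \<le> \<rho>2 * real n ^ (r - 2)"
      using card min_le unfolding cc by linarith+
    define \<Lambda> where "\<Lambda> = lagrangian (joined n r H)"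
    define lm where "lm = real (n choose r) / real n ^ r"
    define l0 where "l0 = real (Suc n choose r) / real (Suc n) ^ r"
    \<comment> \<open>A quarter of the excess over the complete graph on n vertices: for y \<le> y0
      the bound lm + 2 y stays at least 2 y0 below l0.\<close>
    define y0 where "y0 = (l0 - lm) / 4"
    have l0: "l0 \<le> \<Lambda>" unfolding l0_def \<Lambda>_def using r by (intro lagrangian_joined_ge[OF H]) auto
    have "lm < l0" unfolding lm_def l0_def using r n by (intro binomial_over_power_strict_mono) auto
    then have y0: "0 < y0" unfolding y0_def by simp
    define W where "W = degsq n H - (real (r - 2) * real (card H))\<^sup>2 / real n"
    define \<gamma> where "\<gamma> = (1 - e) * W - degsq n C / (1 - e)"
    have \<gamma>: "0 < \<gamma>"
    proof -
      have "0 \<le> degsq n C" unfolding degsq_def by (intro sum_nonneg) auto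
      then have "0 < (1 - \<epsilon>) * W" using lt unfolding W_def by linarith
      then have "0 < W" using eps by (simp add: zero_less_mult_iff)
      have "(1 - \<epsilon>) * W \<le> (1 - e)\<^sup>2 * W"
        using \<open>0 < W\<close> by (intro mult_right_mono) (auto simp: e_def power2_eq_square algebra_simps)
      then have "degsq n C < (1 - e) * ((1 - e) * W)"
        using lt unfolding W_def[symmetric] by (simp add: power2_eq_square mult.assoc)
      then show ?thesis unfolding \<gamma>_def using e by (simp add: pos_divide_less_eq mult.commute)
    qed
    define b0 where "b0 = y0\<^sup>2 / 4 * (1 / (2 * real n)) ^ (r - 2)"
    have b0: "0 < b0" unfolding b0_def using y0 nn by simp
    define gap where "gap = min (2 * y0) (b0\<^sup>2 / 4 * \<gamma>)"
    have gap: "0 < gap" unfolding gap_def using y0 b0 \<gamma> by simp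
    have "lagrangian (joined n r C) \<le> \<Lambda> - gap"
    proof (rule lagrangian_joined_le[OF C])
      fix w y assume adm: "admissible n w y"
      consider "y \<le> y0" | "Phi n r C w y \<le> lm" | "y0 < y" "lm < Phi n r C w y" by linarith
      then show "Phi n r C w y \<le> \<Lambda> - gap"
      proof cases
        case 1
        have "Phi n r C w y \<le> lm + 2 * y" unfolding lm_def by (rule Phi_le_small[OF r2 C adm])
        moreover have "gap \<le> 2 * y0" unfolding gap_def by simp
        moreover have "l0 = lm + 4 * y0" unfolding y0_def by (simp add: field_simps)
        ultimately show ?thesis using 1 l0 by linarith
      next
        case 2
        moreover have "gap \<le> 2 * y0" unfolding gap_def by simp
        moreover have "l0 = lm + 4 * y0" unfolding y0_def by (simp add: field_simps)
        ultimately show ?thesis using l0 y0 by linarith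
      next
        case 3
        have "y \<le> Y / real n" "\<forall>i\<in>{1..n}. w i \<le> Y / real n"
          using ap[OF n(3) C adm] 3 unfolding lm_def by auto
        then have yY: "real n * y \<le> Y" and wY: "\<forall>i\<in>{1..n}. real n * w i \<le> Y"
          using nn by (auto simp: field_simps)
        have "real n * y \<le> real n * (1 / 2)" using yY n(4) by linarith
        then have y2: "y \<le> 1 / 2" using nn by (simp add: mult_le_cancel_left_pos)
        have yy: "0 \<le> y" using y0 3 by linarith
        note y = yy y2 yY
        define b where "b = slope n r y"
        define A where "A = curv n r y"
        have A: "0 < A" "A \<le> 1" unfolding A_def using curv_pos[OF r n(3) y] curv_le_1[OF r n(3) y] by auto
        have "b0 \<le> b" unfolding b0_def b_def slope_def
          using 3 y0 mean_weight_ge[OF r n(3) y] nn by (intro mult_mono divide_right_mono power_mono) auto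
        then have "b0\<^sup>2 / 4 \<le> b\<^sup>2 / (4 * A)"
          using A b0 by (intro frac_le power_mono) auto
        then have "b0\<^sup>2 / 4 * \<gamma> \<le> b\<^sup>2 / (4 * A) * \<gamma>" using \<gamma> by (intro mult_right_mono) auto
        moreover obtain w' where w': "admissible n w' y" and "base n r y + b * real (card H)
           + b\<^sup>2 / (4 * A) * ((1 - e) * W) \<le> Phi n r H w' y"
          using low[OF n(1) y H card1] unfolding b_def A_def W_def by blast
        moreover have "Phi n r H w' y \<le> \<Lambda>" unfolding \<Lambda>_def by (rule Phi_le_lagrangian[OF H w'])
        moreover have "Phi n r C w y \<le> base n r y + b * real (card H) + b\<^sup>2 / (4 * A) * (degsq n C / (1 - e))"
          using up[OF n(2) adm yY wY C card2] unfolding b_def A_def cc .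
        moreover have "b\<^sup>2 / (4 * A) * \<gamma> = b\<^sup>2 / (4 * A) * ((1 - e) * W) - b\<^sup>2 / (4 * A) * (degsq n C / (1 - e))"
          unfolding \<gamma>_def by (rule right_diff_distrib)
        moreover have "gap \<le> b0\<^sup>2 / 4 * \<gamma>" unfolding gap_def by simp
        ultimately show ?thesis by linarith
      qed
    qed
    then show "lagrangian (joined n r C) < lagrangian (joined n r H)"
      using gap unfolding \<Lambda>_def by linarith
  qed
qed

section \<open>Initial segments of the colex order\<close>

lemma colex_key_inj: "finite A \<Longrightarrow> finite B \<Longrightarrow> colex_key A = colex_key B \<Longrightarrow> A = B"
  using set_encode_eq[of A B] by (simp add: colex_key_def set_encode_def)

lemma colex_key_less:
  assumes "A \<subseteq> {..<k}"
  shows "colex_key A < 2 ^ k"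
proof -
  have "colex_key A \<le> (\<Sum>i<k. 2 ^ i)"
    unfolding colex_key_def using assms by (intro sum_mono2) auto
  also have "\<dots> < 2 ^ k" by (simp add: sum_power2 flip: atLeast0LessThan)
  finally show ?thesis .
qed

lemma ksets_eq_r_sets: "ksets {1..k} q = {A \<in> r_sets q. A \<subseteq> {1..k}}"
  unfolding ksets_def r_sets_def by (auto dest: finite_subset)

text \<open>An element j > k contributes 2^j, which exceeds the key of every subset of
  {1..k}.\<close>

lemma colex_below:
  assumes A: "A \<subseteq> {1..k}" and B: "B \<in> r_sets q" "colex_key B < colex_key A"
  shows "B \<in> ksets {1..k} q"
proof -
  have "j \<le> k" if "j \<in> B" for j
  proof (rule ccontr)
    assume "\<not> j \<le> k"
    have "A \<subseteq> {..<Suc k}" using A by auto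
    then have "colex_key A < 2 ^ Suc k" by (rule colex_key_less)
    also have "\<dots> \<le> 2 ^ j" using \<open>\<not> j \<le> k\<close> by (intro power_increasing) auto
    also have "\<dots> \<le> colex_key B"
      unfolding colex_key_def using that B(1) by (intro member_le_sum) (auto simp: r_sets_def)
    finally show False using B(2) by simp
  qed
  then show ?thesis using B(1) unfolding ksets_eq_r_sets by (auto simp: r_sets_def)
qed

lemma finite_colex_below: "A \<in> r_sets q \<Longrightarrow> finite {B \<in> r_sets p. colex_key B < colex_key A}"
proof -
  assume "A \<in> r_sets q"
  then have A: "finite A" "A \<subseteq> {1..}" by (auto simp: r_sets_def)
  then have "A \<subseteq> {1..Max A}" by auto
  then have "{B \<in> r_sets p. colex_key B < colex_key A} \<subseteq> ksets {1..Max A} p"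
    using colex_below by blast
  then show ?thesis by (rule finite_subset) simp
qed

text \<open>\<open>colex_initial\<close> is given by ranks, and down-closure is the handle on it: a
  member of a finite down-closed \<open>F\<close> has fewer than card F predecessors, while a set
  outside \<open>F\<close> has all of \<open>F\<close> below it.\<close>

lemma colex_initial_card:
  assumes F: "finite F" "F \<subseteq> r_sets q"
    and down: "\<And>A B. A \<in> F \<Longrightarrow> B \<in> r_sets q \<Longrightarrow> colex_key B < colex_key A \<Longrightarrow> B \<in> F"
  shows "colex_initial (card F) q = F"
proof
  show "F \<subseteq> colex_initial (card F) q"
  proof
    fix A assume A: "A \<in> F"
    have "{B \<in> r_sets q. colex_key B < colex_key A} \<subseteq> F - {A}" using down[OF A] by auto
    then have "card {B \<in> r_sets q. colex_key B < colex_key A} \<le> card (F - {A})"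
      using F by (intro card_mono) auto
    also have "\<dots> < card F" using A F by (intro card_Diff1_less)
    finally show "A \<in> colex_initial (card F) q" using A F unfolding colex_initial_def by auto
  qed
  show "colex_initial (card F) q \<subseteq> F"
  proof (rule ccontr)
    assume "\<not> colex_initial (card F) q \<subseteq> F"
    then obtain A where A: "A \<in> r_sets q" "card {B \<in> r_sets q. colex_key B < colex_key A} < card F" "A \<notin> F"
      unfolding colex_initial_def by auto
    have "F \<subseteq> {B \<in> r_sets q. colex_key B < colex_key A}"
    proof
      fix B assume B: "B \<in> F"
      have "B \<noteq> A" using A B by auto
      moreover have "finite A" "finite B" using A B F by (auto simp: r_sets_def)
      ultimately have "colex_key B \<noteq> colex_key A" using colex_key_inj by blast
      moreover have "\<not> colex_key A < colex_key B" using down[OF B A(1)] A(3) by blast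
      ultimately show "B \<in> {B \<in> r_sets q. colex_key B < colex_key A}" using B F by auto
    qed
    then have "card F \<le> card {B \<in> r_sets q. colex_key B < colex_key A}"
      by (rule card_mono[OF finite_colex_below[OF A(1)]])
    then show False using A(2) by simp
  qed
qed

lemma colex_initial_binomial: "colex_initial (k choose q) q = ksets {1..k} q"
proof -
  have "colex_initial (card (ksets {1..k} q)) q = ksets {1..k} q"
  proof (rule colex_initial_card)
    show "ksets {1..k} q \<subseteq> r_sets q" unfolding ksets_eq_r_sets by blast
    show "B \<in> ksets {1..k} q"
      if "A \<in> ksets {1..k} q" "B \<in> r_sets q" "colex_key B < colex_key A" for A B
      by (rule colex_below[OF ksetsD(1)[OF that(1)] that(2,3)])
  qed simp
  then show ?thesis by (simp add: card_ksets)
qed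

lemma colex_initial_mono: "s \<le> s' \<Longrightarrow> colex_initial s q \<subseteq> colex_initial s' q"
  unfolding colex_initial_def by auto

lemma colex_initial_down:
  assumes "A \<in> colex_initial s q" "B \<in> r_sets q" "colex_key B < colex_key A"
  shows "B \<in> colex_initial s q"
proof -
  have A: "A \<in> r_sets q" "card {B \<in> r_sets q. colex_key B < colex_key A} < s"
    using assms(1) by (auto simp: colex_initial_def)
  have "card {C \<in> r_sets q. colex_key C < colex_key B} \<le> card {C \<in> r_sets q. colex_key C < colex_key A}"
    using assms(3) by (intro card_mono finite_colex_below[OF A(1)]) auto
  then show ?thesis using A(2) assms(2) unfolding colex_initial_def by auto
qed

text \<open>Ranks map the C(k, q) sets of size q in {1..k} injectively into the numbers below C(k,
  q), hence onto them; so each rank below s is taken exactly once.\<close>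

lemma card_colex_initial:
  assumes s: "s \<le> k choose q"
  shows "card (colex_initial s q) = s"
proof -
  define F where "F = ksets {1..k} q"
  define R where "R A = card {B \<in> r_sets q. colex_key B < colex_key A}" for A
  have F: "finite F" "card F = k choose q" "F \<subseteq> r_sets q"
  proof -
    show "finite F" "card F = k choose q" unfolding F_def by (simp_all add: card_ksets)
    show "F \<subseteq> r_sets q" unfolding F_def ksets_eq_r_sets by blast
  qed
  have mono: "R A < R B" if "A \<in> F" "B \<in> F" "colex_key A < colex_key B" for A B
  proof -
    have "B \<in> r_sets q" using that F by auto
    moreover have "A \<in> {C \<in> r_sets q. colex_key C < colex_key B}" using that F by auto
    ultimately show ?thesis unfolding R_def using that(3)
      by (intro psubset_card_mono finite_colex_below) (auto intro: less_trans)
  qed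
  have inj: "inj_on R F"
  proof (rule inj_onI)
    fix A B assume AB: "A \<in> F" "B \<in> F" "R A = R B"
    then have "colex_key A = colex_key B" using mono by (metis less_irrefl linorder_neqE_nat)
    moreover have "finite A" "finite B" using AB F by (auto simp: r_sets_def)
    ultimately show "A = B" using colex_key_inj by blast
  qed
  have "R ` F \<subseteq> {..<k choose q}"
    using colex_initial_binomial[of k q] unfolding F_def R_def colex_initial_def by auto
  moreover have "card (R ` F) = card {..<k choose q}" using card_image[OF inj] F by simp
  ultimately have im: "R ` F = {..<k choose q}" by (intro card_subset_eq) auto
  have "colex_initial s q = {A \<in> F. R A < s}"
    using colex_initial_mono[OF s, of q] colex_initial_binomial[of k q] F
    unfolding F_def R_def colex_initial_def by auto
  moreover have "R ` {A \<in> F. R A < s} = {..<s}"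
  proof -
    have "R ` {A \<in> F. R A < s} = R ` F \<inter> {..<s}" by auto
    then show ?thesis unfolding im using s by auto
  qed
  moreover have "inj_on R {A \<in> F. R A < s}" using inj by (rule inj_on_subset) auto
  ultimately show ?thesis using card_image by (metis card_lessThan)
qed

section \<open>The colex graph as a joined graph\<close>

lemma joined_iff:
  assumes H: "H \<subseteq> ksets {1..n} (r - 2)" and r: "2 \<le> r"
  shows "A \<in> joined n r H \<longleftrightarrow> A \<in> ksets {1..n + 2} r \<and> (n + 1 \<in> A \<longrightarrow> n + 2 \<in> A \<longrightarrow> A - {n + 1, n + 2} \<in> H)"
    (is "_ \<longleftrightarrow> ?R")
proof
  have not_in: "n + 1 \<notin> S" "n + 2 \<notin> S" if "S \<in> ksets {1..n} k" for S k
    using ksets_mem[OF that, of "n + 1"] ksets_mem[OF that, of "n + 2"] by auto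
  assume A: "A \<in> joined n r H"
  have "A - {n + 1, n + 2} \<in> H" if "n + 1 \<in> A" "n + 2 \<in> A"
  proof -
    have "A \<notin> ksets {1..n} r" using that not_in by blast
    moreover have "A \<notin> insert (n + 1) ` ksets {1..n} (r - 1)" using that not_in(2) by auto
    moreover have "A \<notin> insert (n + 2) ` ksets {1..n} (r - 1)" using that not_in(1) by auto
    ultimately have "A \<in> (\<lambda>B. insert (n + 1) (insert (n + 2) B)) ` H"
      using A unfolding joined_def by blast
    then obtain B where B: "A = insert (n + 1) (insert (n + 2) B)" "B \<in> H" by blast
    then have "B \<in> ksets {1..n} (r - 2)" using H by blast
    then have "A - {n + 1, n + 2} = B" using not_in unfolding B(1) by blast
    then show ?thesis using B(2) by simp
  qed
  then show ?R using A joined_subset[OF H r] by blast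
next
  assume R: ?R
  then have A: "A \<subseteq> {1..n + 2}" "card A = r" "finite A" by (auto simp: ksets_def dest: finite_subset)
  consider "n + 1 \<notin> A" "n + 2 \<notin> A" | "n + 1 \<in> A" "n + 2 \<notin> A" | "n + 1 \<notin> A" "n + 2 \<in> A" | "n + 1 \<in> A" "n + 2 \<in> A"
    by blast
  then show "A \<in> joined n r H"
  proof cases
    case 1
    have "x \<in> {1..n}" if "x \<in> A" for x
    proof -
      have "x \<in> {1..n + 2}" "x \<noteq> n + 1" "x \<noteq> n + 2" using that A 1 by auto
      then show ?thesis by auto
    qed
    then have "A \<in> ksets {1..n} r" using A by (auto simp: ksets_def)
    then show ?thesis unfolding joined_def by blast
  next
    case 2
    have "x \<in> {1..n}" if "x \<in> A - {n + 1}" for x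
    proof -
      have "x \<in> {1..n + 2}" "x \<noteq> n + 1" "x \<noteq> n + 2" using that A 2 by auto
      then show ?thesis by auto
    qed
    then have "A - {n + 1} \<in> ksets {1..n} (r - 1)" using A 2 unfolding ksets_def by (simp add: subset_eq)
    moreover have "A = insert (n + 1) (A - {n + 1})" using 2 by auto
    ultimately show ?thesis unfolding joined_def by blast
  next
    case 3
    have "x \<in> {1..n}" if "x \<in> A - {n + 2}" for x
    proof -
      have "x \<in> {1..n + 2}" "x \<noteq> n + 1" "x \<noteq> n + 2" using that A 3 by auto
      then show ?thesis by auto
    qed
    then have "A - {n + 2} \<in> ksets {1..n} (r - 1)" using A 3 unfolding ksets_def by (simp add: subset_eq)
    moreover have "A = insert (n + 2) (A - {n + 2})" using 3 by auto
    ultimately show ?thesis unfolding joined_def by blast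
  next
    case 4
    then have "A - {n + 1, n + 2} \<in> H" using R by blast
    moreover have "A = insert (n + 1) (insert (n + 2) (A - {n + 1, n + 2}))" using 4 by auto
    ultimately show ?thesis unfolding joined_def by blast
  qed
qed

text \<open>Among the r-subsets of {1..n+2} those containing both n + 1 and n + 2 come last, and
  they are ordered as the remainders left after deleting these two points.\<close>

lemma colex_initial_joined:
  assumes r: "2 \<le> r" and s: "s \<le> n choose (r - 2)"
  shows "colex_initial ((n choose r) + 2 * (n choose (r - 1)) + s) r = joined n r (colex_initial s (r - 2))"
proof -
  define C where "C = colex_initial s (r - 2)"
  have C: "C \<subseteq> ksets {1..n} (r - 2)"
    using colex_initial_mono[OF s, of "r - 2"] unfolding C_def colex_initial_binomial .
  note iff = joined_iff[OF C r]
  have "colex_initial (card (joined n r C)) r = joined n r C"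
  proof (rule colex_initial_card)
    show "finite (joined n r C)" using finite_subset[OF joined_subset[OF C r]] by simp
    show "joined n r C \<subseteq> r_sets r" using joined_subset[OF C r] unfolding ksets_eq_r_sets by auto
    fix A B assume A: "A \<in> joined n r C" and B: "B \<in> r_sets r" and lt: "colex_key B < colex_key A"
    have AK: "A \<subseteq> {1..n + 2}" "finite A" using A iff by (auto simp: ksets_def dest: finite_subset)
    have BK: "B \<in> ksets {1..n + 2} r" by (rule colex_below[OF AK(1) B lt])
    then have Bs: "B \<subseteq> {1..n + 2}" "finite B" "card B = r" by (auto simp: ksets_def dest: finite_subset)
    show "B \<in> joined n r C"
      unfolding iff
    proof (intro conjI impI BK)
      assume in_B: "n + 1 \<in> B" "n + 2 \<in> B"
      have key: "colex_key D = 2 ^ (n + 1) + 2 ^ (n + 2) + colex_key (D - {n + 1, n + 2})"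
        if "finite D" "n + 1 \<in> D" "n + 2 \<in> D" for D
      proof -
        have "D - {n + 1, n + 2} = D - {n + 1} - {n + 2}" by auto
        then show ?thesis
          using that sum.remove[of D "n + 1" "\<lambda>i. 2 ^ i :: nat"] sum.remove[of "D - {n + 1}" "n + 2" "\<lambda>i. 2 ^ i :: nat"]
          unfolding colex_key_def by simp
      qed
      \<comment> \<open>The key of \<open>B\<close> is at least 2^(n+1) + 2^(n+2). A set lacking n +
        2, or lacking only n + 1, has a smaller key and cannot lie above \<open>B\<close>.\<close>
      have "n + 2 \<in> A"
      proof (rule ccontr)
        assume no: "n + 2 \<notin> A"
        have "A \<subseteq> {..<n + 2}"
        proof
          fix x assume "x \<in> A"
          then have "x \<in> {1..n + 2}" "x \<noteq> n + 2" using AK no by auto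
          then show "x \<in> {..<n + 2}" by auto
        qed
        then have "colex_key A < 2 ^ (n + 2)" by (rule colex_key_less)
        then show False using key[OF Bs(2) in_B] lt by simp
      qed
      moreover have "n + 1 \<in> A"
      proof (rule ccontr)
        assume no: "n + 1 \<notin> A"
        have "A - {n + 2} \<subseteq> {..<n + 1}"
        proof
          fix x assume "x \<in> A - {n + 2}"
          then have "x \<in> {1..n + 2}" "x \<noteq> n + 2" "x \<noteq> n + 1" using AK no by auto
          then show "x \<in> {..<n + 1}" by auto
        qed
        then have "colex_key (A - {n + 2}) < 2 ^ (n + 1)" by (rule colex_key_less)
        moreover have "colex_key A = 2 ^ (n + 2) + colex_key (A - {n + 2})"
          using AK(2) \<open>n + 2 \<in> A\<close> unfolding colex_key_def by (rule sum.remove)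
        ultimately show False using key[OF Bs(2) in_B] lt by simp
      qed
      ultimately have "A - {n + 1, n + 2} \<in> C" using A iff by blast
      moreover have "colex_key (B - {n + 1, n + 2}) < colex_key (A - {n + 1, n + 2})"
        using lt key[OF Bs(2) in_B] key[OF AK(2) \<open>n + 1 \<in> A\<close> \<open>n + 2 \<in> A\<close>] by simp
      moreover have "B - {n + 1, n + 2} \<in> r_sets (r - 2)"
        using Bs in_B unfolding r_sets_def by (auto simp: card_Diff_subset)
      ultimately show "B - {n + 1, n + 2} \<in> C" unfolding C_def using colex_initial_down by blast
    qed
  qed
  moreover have "card C = s" unfolding C_def by (rule card_colex_initial[OF s])
  ultimately show ?thesis using card_joined[OF C] unfolding C_def by simp
qed

section \<open>Degree-square sums\<close>

lemma degsq_eq_pairs: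
  assumes H: "H \<subseteq> ksets {1..n} q"
  shows "degsq n H = (\<Sum>e\<in>H. \<Sum>f\<in>H. real (card (e \<inter> f)))"
proof -
  have fH: "finite H" using finite_subset[OF H] by simp
  have "degsq n H = (\<Sum>e\<in>H. \<Sum>i\<in>e. real (deg H i))"
    unfolding degsq_def power2_eq_square by (rule sum_deg[OF _ H, symmetric]) simp
  also have "\<dots> = (\<Sum>e\<in>H. \<Sum>f\<in>H. real (card (e \<inter> f)))"
  proof (rule sum.cong[OF refl])
    fix e assume "e \<in> H"
    then have "finite e" using H by (auto simp: ksets_def dest: finite_subset)
    have "(\<Sum>i\<in>e. real (deg H i)) = (\<Sum>i\<in>e. \<Sum>f | f \<in> H \<and> i \<in> f. 1)"
      by (simp add: deg_def)
    also have "\<dots> = (\<Sum>f\<in>H. \<Sum>i | i \<in> e \<and> i \<in> f. 1)"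
      by (rule sum.swap_restrict[OF \<open>finite e\<close> fH])
    finally show "(\<Sum>i\<in>e. real (deg H i)) = (\<Sum>f\<in>H. real (card (e \<inter> f)))"
      by (simp add: Int_def)
  qed
  finally show ?thesis .
qed

text \<open>Distinct edges meet in at most q - 1 points and an edge meets itself in q, whence (q -
  1) s^2 + s for s edges. The ordered pair (e0, f0) alone accounts for the deficit of 1.\<close>

lemma degsq_le_pair:
  assumes H: "H \<subseteq> ksets {1..n} q" and e0: "e0 \<in> H" "f0 \<in> H" "e0 \<noteq> f0" and small: "card (e0 \<inter> f0) + 2 \<le> q"
  shows "degsq n H \<le> (real q - 1) * (real (card H))\<^sup>2 + real (card H) - 1"
proof -
  have fH: "finite H" using finite_subset[OF H] by simp
  have fin: "finite e" "card e = q" if "e \<in> H" for e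
    using that H by (auto simp: ksets_def dest: finite_subset)
  have le: "real (card (e \<inter> f)) \<le> (real q - 1) + (if f = e then 1 else 0) - (if f = f0 then (if e = e0 then 1 else 0) else 0)"
    if "e \<in> H" "f \<in> H" for e f
  proof (cases "f = e")
    case True
    then show ?thesis using fin[OF that(1)] e0(3) by auto
  next
    case False
    have "e \<inter> f \<noteq> e"
    proof
      assume "e \<inter> f = e"
      then have "e \<subseteq> f" by blast
      then show False using False fin[OF that(1)] fin[OF that(2)] card_subset_eq by metis
    qed
    then have "card (e \<inter> f) < card e" using fin[OF that(1)] by (intro psubset_card_mono) auto
    then have "real (card (e \<inter> f)) \<le> real q - 1" using fin[OF that(1)] by simp
    then show ?thesis using False small by auto
  qed
  have "degsq n H \<le> (\<Sum>e\<in>H. \<Sum>f\<in>H. (real q - 1) + (if f = e then 1 else 0) - (if f = f0 then (if e = e0 then 1 else 0) else 0))"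
    unfolding degsq_eq_pairs[OF H] by (intro sum_mono le)
  also have "\<dots> = (\<Sum>e\<in>H. real (card H) * (real q - 1) + 1 - (if e = e0 then 1 else 0))"
    by (intro sum.cong refl) (simp add: sum.distrib sum_subtractf fH e0)
  also have "\<dots> = real (card H) * (real (card H) * (real q - 1)) + real (card H) - 1"
    by (simp add: sum.distrib sum_subtractf fH e0 distrib_left)
  finally show ?thesis by (simp add: power2_eq_square mult_ac)
qed

text \<open>Colex contains all q-subsets of {1..q+1} and, as s \<ge> q + 2, a further set f with at
  most q - 1 points there. Omitting a point of f from {1..q+1}, if there is one, gives an edge that
  meets f in at most q - 2 points.\<close>

lemma degsq_colex_initial_small:
  assumes q: "2 \<le> q" and s: "q + 2 \<le> s" "s \<le> n choose q"
  shows "degsq n (colex_initial s q) \<le> (real q - 1) * (real s)\<^sup>2 + real s - 1"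
proof -
  define C where "C = colex_initial s q"
  have C: "C \<subseteq> ksets {1..n} q"
    using colex_initial_mono[OF s(2), of q] unfolding C_def colex_initial_binomial .
  have card: "card C = s" unfolding C_def by (rule card_colex_initial[OF s(2)])
  have "(q + 1) choose q \<le> s" using s by simp
  then have K: "ksets {1..q + 1} q \<subseteq> C"
    using colex_initial_mono[of "(q + 1) choose q" s q] unfolding C_def colex_initial_binomial by blast
  have "card (ksets {1..q + 1} q) = q + 1" by (simp add: card_ksets)
  then have "\<not> C \<subseteq> ksets {1..q + 1} q"
    using card_mono[of "ksets {1..q + 1} q" C] card s by auto
  then obtain f where f: "f \<in> C" "f \<notin> ksets {1..q + 1} q" by blast
  have fq: "card f = q" "finite f" "f \<subseteq> {1..n}"
    using f C by (auto simp: ksets_def dest: finite_subset)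
  then have "\<not> f \<subseteq> {1..q + 1}" using f by (auto simp: ksets_def)
  then have "card (f \<inter> {1..q + 1}) < q"
    using psubset_card_mono[of f "f \<inter> {1..q + 1}"] fq by blast
  \<comment> \<open>If f misses {1..q+1} altogether, any point will do and 1 is the default.\<close>
  obtain x where x: "x \<in> {1..q + 1}" "f \<inter> {1..q + 1} \<noteq> {} \<Longrightarrow> x \<in> f"
  proof (cases "f \<inter> {1..q + 1} = {}")
    case True
    then show ?thesis using that[of 1] by simp
  next
    case False
    then show ?thesis using that by blast
  qed
  define e where "e = {1..q + 1} - {x}"
  have "e \<in> ksets {1..q + 1} q" using x unfolding e_def ksets_def by auto
  then have e: "e \<in> C" "e \<noteq> f" using K f by auto
  have "card (e \<inter> f) + 2 \<le> q"
  proof (cases "f \<inter> {1..q + 1} = {}")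
    case True
    then have "e \<inter> f = {}" unfolding e_def by blast
    then show ?thesis using q by simp
  next
    case False
    then have "e \<inter> f = f \<inter> {1..q + 1} - {x}" "x \<in> f \<inter> {1..q + 1}" using x unfolding e_def by auto
    then have "card (e \<inter> f) < card (f \<inter> {1..q + 1})" using fq by (simp only: card_Diff1_less finite_Int simp_thms)
    then show ?thesis using \<open>card (f \<inter> {1..q + 1}) < q\<close> by linarith
  qed
  from degsq_le_pair[OF C e(1) f(1) e(2) this] show ?thesis unfolding card unfolding C_def .
qed

text \<open>The sunflower has core {1..q-1} and one further point of {q..<q+s} in each edge. Core
  vertices have degree s and the others at least 1, which already reaches the general bound (q - 1)
  s^2 + s.\<close>

lemma exists_star:
  assumes q: "1 \<le> q" and n: "q - 1 + s \<le> n"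
  shows "\<exists>H \<subseteq> ksets {1..n} q. card H = s \<and> (real q - 1) * (real s)\<^sup>2 + real s \<le> degsq n H"
proof -
  define H where "H = (\<lambda>x. insert x {1..q - 1}) ` {q..<q + s}"
  have inj: "inj_on (\<lambda>x. insert x {1..q - 1}) {q..<q + s}"
  proof (rule inj_onI)
    fix x y assume "x \<in> {q..<q + s}" "y \<in> {q..<q + s}" and eq: "insert x {1..q - 1} = insert y {1..q - 1}"
    then have "x \<notin> {1..q - 1}" using q by auto
    then show "x = y" using eq by blast
  qed
  have cardH: "card H = s" unfolding H_def using card_image[OF inj] by simp
  have "insert x {1..q - 1} \<in> ksets {1..n} q" if "x \<in> {q..<q + s}" for x
  proof -
    have "x \<notin> {1..q - 1}" "x \<in> {1..n}" "{1..q - 1} \<subseteq> {1..n}" using that q n by auto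
    then show ?thesis using q unfolding ksets_def by simp
  qed
  then have H: "H \<subseteq> ksets {1..n} q" unfolding H_def by blast
  have fH: "finite H" unfolding H_def by simp
  have d1: "deg H i = s" if "i \<in> {1..q - 1}" for i
  proof -
    have "{e \<in> H. i \<in> e} = H" using that unfolding H_def by auto
    then show ?thesis unfolding deg_def by (simp only: cardH)
  qed
  have d2: "1 \<le> deg H i" if "i \<in> {q..<q + s}" for i
  proof -
    have "insert i {1..q - 1} \<in> {e \<in> H. i \<in> e}" using that unfolding H_def by blast
    then have "0 < card {e \<in> H. i \<in> e}" using fH by (intro card_gt_0_iff[THEN iffD2]) auto
    then show ?thesis unfolding deg_def by linarith
  qed
  have "(real q - 1) * (real s)\<^sup>2 + real s = (\<Sum>i\<in>{1..q - 1}. (real s)\<^sup>2) + (\<Sum>i\<in>{q..<q + s}. 1)"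
    using q by (simp add: of_nat_diff)
  also have "\<dots> \<le> (\<Sum>i\<in>{1..q - 1}. (real (deg H i))\<^sup>2) + (\<Sum>i\<in>{q..<q + s}. (real (deg H i))\<^sup>2)"
  proof (intro add_mono sum_mono)
    fix i assume "i \<in> {q..<q + s}"
    then show "1 \<le> (real (deg H i))\<^sup>2" using d2[of i] by (simp add: one_le_power)
  qed (use d1 in auto)
  also have "\<dots> = (\<Sum>i\<in>{1..q - 1} \<union> {q..<q + s}. (real (deg H i))\<^sup>2)"
    by (rule sum.union_disjoint[symmetric]) auto
  also have "\<dots> \<le> degsq n H"
    unfolding degsq_def using n q by (intro sum_mono2) auto
  finally show ?thesis using H cardH by blast
qed

text \<open>The family lives on {1..k+1}, so its degrees are at most C(k, q-1), and a sum of squares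
  is at most the largest degree times the degree sum.\<close>

lemma degsq_colex_initial_le:
  assumes q: "1 \<le> q" and s: "s \<le> Suc k choose q" and k: "k < n"
  shows "degsq n (colex_initial s q) \<le> real (k choose (q - 1)) * (real q * real s)"
proof -
  define C where "C = colex_initial s q"
  have C: "C \<subseteq> ksets {1..Suc k} q"
    using colex_initial_mono[OF s, of q] unfolding C_def colex_initial_binomial .
  have card: "card C = s" unfolding C_def by (rule card_colex_initial[OF s])
  have Cn: "C \<subseteq> ksets {1..n} q" using C k unfolding ksets_def by force
  have "degsq n C \<le> (\<Sum>i\<in>{1..n}. real (k choose (q - 1)) * real (deg C i))"
    unfolding degsq_def power2_eq_square
  proof (intro sum_mono mult_right_mono)
    fix i show "real (deg C i) \<le> real (k choose (q - 1))"
      using deg_le[OF _ C q, of i] by simp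
  qed simp
  also have "\<dots> = real (k choose (q - 1)) * (real q * real s)"
    unfolding sum_distrib_left[symmetric] using sum_deg_eq[OF _ Cn] card by simp
  finally show ?thesis unfolding C_def .
qed

text \<open>A full star has \<open>D\<close> edges. If s \<le> D, then s edges of one star give s^2.
  Otherwise p = s div D full stars have at most p D \<le> s edges together and can be filled up to
  s; their centres give p D^2 \<ge> s D / 2, because s < (p + 1) D \<le> 2 p D.\<close>

lemma exists_high_degsq:
  assumes q: "1 \<le> q" and n: "1 \<le> n" and s: "s \<le> n choose q"
  shows "\<exists>H \<subseteq> ksets {1..n} q. card H = s \<and>
    real s * min (real s) (real ((n - 1) choose (q - 1))) / 2 \<le> degsq n H"
proof -
  define D where "D = (n - 1) choose (q - 1)"
  define St where "St i = {S \<in> ksets {1..n} q. {i} \<subseteq> S}" for i :: nat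
  have St: "card (St i) = D" if "i \<in> {1..n}" for i
    using card_ksets_superset[of "{1..n}" "{i}" q] that q unfolding St_def D_def by simp
  have dmem: "(real (deg H i))\<^sup>2 \<le> degsq n H" if "i \<in> {1..n}" for H i
    unfolding degsq_def by (rule member_le_sum[OF that]) auto
  show ?thesis
  proof (cases "s \<le> D")
    case True
    then have "s \<le> card (St 1)" using St[of 1] n by simp
    then obtain H where H: "H \<subseteq> St 1" "card H = s" "finite H" by (rule obtain_subset_with_card_n)
    have "{e \<in> H. 1 \<in> e} = H" using H(1) unfolding St_def by auto
    then have "deg H 1 = s" unfolding deg_def by (simp only: H(2))
    then have "(real s)\<^sup>2 \<le> degsq n H" using dmem[of 1 H] n by simp
    moreover have "real s * min (real s) (real D) / 2 \<le> (real s)\<^sup>2"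
      using True by (simp add: power2_eq_square)
    moreover have "H \<subseteq> ksets {1..n} q" using H(1) unfolding St_def by blast
    ultimately have "H \<subseteq> ksets {1..n} q \<and> card H = s \<and> real s * min (real s) (real D) / 2 \<le> degsq n H"
      using H(2) by linarith
    then show ?thesis unfolding D_def by blast
  next
    case False
    then have "0 < n choose q" using s by linarith
    then have "q \<le> n" by simp
    then have D0: "0 < D" using q unfolding D_def by simp
    define p where "p = s div D"
    have pD: "p * D \<le> s" unfolding p_def by simp
    \<comment> \<open>Leads to p \<le> n, so that there are enough centres for p stars.\<close>
    have "q * (n choose q) = n * D" unfolding D_def using q by (intro times_binomial_minus1_eq) auto
    moreover have "1 * (n choose q) \<le> q * (n choose q)" using q by (intro mult_right_mono) auto
    ultimately have "p * D \<le> n * D" using pD s by linarith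
    then have pn: "p \<le> n" using D0 by simp
    define T where "T = (\<Union>i\<in>{1..p}. St i)"
    have "card T \<le> (\<Sum>i\<in>{1..p}. card (St i))" unfolding T_def by (rule card_UN_le) simp
    also have "\<dots> = p * D" using St pn by simp
    finally have "card T \<le> s" using pD by linarith
    moreover have "s \<le> card (ksets {1..n} q)" using s by (simp add: card_ksets)
    moreover have "T \<subseteq> ksets {1..n} q" unfolding T_def St_def by blast
    ultimately obtain H where H: "T \<subseteq> H" "H \<subseteq> ksets {1..n} q" "card H = s"
      using exists_subset_between[of T s "ksets {1..n} q"] by auto
    have fH: "finite H" using finite_subset[OF H(2)] by simp
    have d: "D \<le> deg H i" if "i \<in> {1..p}" for i
    proof -
      have "St i \<subseteq> H" using that H(1) unfolding T_def by blast
      then have "St i \<subseteq> {e \<in> H. i \<in> e}" unfolding St_def by blast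
      then have "card (St i) \<le> deg H i" unfolding deg_def using fH by (intro card_mono) auto
      then show ?thesis using St[of i] that pn by simp
    qed
    have "s < Suc p * D" unfolding p_def using D0 by (metis dividend_less_times_div mult.commute mult_Suc)
    moreover have "1 \<le> p" unfolding p_def using False D0 by (simp add: div_greater_zero_iff Suc_le_eq)
    then have "Suc p * D \<le> 2 * p * D" by (intro mult_right_mono) auto
    ultimately have "real s \<le> 2 * real p * real D" by (metis less_imp_le less_le_trans of_nat_le_iff of_nat_mult of_nat_numeral)
    then have "real s * real D \<le> 2 * real p * real D * real D" by (intro mult_right_mono) auto
    then have "real s * real D / 2 \<le> real p * (real D)\<^sup>2" by (simp add: power2_eq_square)
    also have "\<dots> = (\<Sum>i\<in>{1..p}. (real D)\<^sup>2)" by simp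
    also have "\<dots> \<le> (\<Sum>i\<in>{1..p}. (real (deg H i))\<^sup>2)"
      using d by (intro sum_mono power_mono) auto
    also have "\<dots> \<le> degsq n H" unfolding degsq_def using pn by (intro sum_mono2) auto
    finally have "real s * real D / 2 \<le> degsq n H" .
    moreover have "real s * min (real s) (real D) / 2 \<le> real s * real D / 2"
      by (intro divide_right_mono mult_left_mono) auto
    ultimately have "H \<subseteq> ksets {1..n} q \<and> card H = s \<and> real s * min (real s) (real D) / 2 \<le> degsq n H"
      using H(2,3) by linarith
    then show ?thesis unfolding D_def by blast
  qed
qed

section \<open>The degree-square gap for bounded and for large s\<close>

lemma binomial_ratio_le:
  assumes "1 \<le> j" "k \<le> M"
  shows "real M * real (k choose j) \<le> real k * real (M choose j)"
proof -
  have "j * (k choose j) = k * ((k - 1) choose (j - 1))" "j * (M choose j) = M * ((M - 1) choose (j - 1))"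
    using assms by (intro times_binomial_minus1_eq; simp)+
  moreover have "(k - 1) choose (j - 1) \<le> (M - 1) choose (j - 1)"
    using assms by (intro binomial_right_mono) auto
  then have "M * (k * ((k - 1) choose (j - 1))) \<le> k * (M * ((M - 1) choose (j - 1)))"
    by (simp add: mult_ac)
  ultimately have "j * (M * (k choose j)) \<le> j * (k * (M choose j))" by (metis mult.left_commute)
  then have "M * (k choose j) \<le> k * (M choose j)" using assms by simp
  then show ?thesis by (metis of_nat_le_iff of_nat_mult)
qed

text \<open>C(k, q-1) bounds the degrees in colex and must lie well below both s and a full star,
  the two sizes in \<open>exists_high_degsq\<close>. Against s this needs k of order q^2, the source
  of 16 q^2 + 2 q. Against the star, either n is at most a constant times k and the small proportion
  of s among all q-sets is used, or the ratio k / n is itself small.\<close>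

lemma shadow_binomial_le:
  fixes k q n s :: nat
  assumes q: "2 \<le> q" and k: "16 * q\<^sup>2 + 2 * q \<le> k" "k < n" and ks: "k choose q \<le> s"
    and sn: "real s \<le> real (n choose q) / (1024 * (real q)\<^sup>2)"
  shows "16 * real q * real (k choose (q - 1)) \<le> min (real s) (real ((n - 1) choose (q - 1)))"
proof -
  define D where "D = real ((n - 1) choose (q - 1))"
  define E where "E = real (k choose (q - 1))"
  define d where "d = real (k - (q - 1))"
  have dq: "16 * (real q)\<^sup>2 \<le> d" "real k \<le> 2 * d"
  proof -
    have "16 * q\<^sup>2 \<le> k - (q - 1)" "k \<le> 2 * (k - (q - 1))" using k q by linarith+
    then show "16 * (real q)\<^sup>2 \<le> d" "real k \<le> 2 * d" unfolding d_def
      by (metis of_nat_le_iff of_nat_mult of_nat_numeral of_nat_power)+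
  qed
  have q0: "0 < real q" using q by simp
  have d0: "0 < d" using dq(1) q0 by (smt (verit) zero_less_power)
  have E0: "0 \<le> E" and D0: "0 \<le> D" unfolding E_def D_def by simp_all
  have "Suc (q - 1) = q" using q by simp
  then have step: "real q * real (k choose q) = E * d"
    using binomial_step[of "q - 1" k] k q unfolding E_def d_def by (simp add: mult.commute)
  have "q * (n choose q) = n * ((n - 1) choose (q - 1))" using q by (intro times_binomial_minus1_eq) auto
  then have nD: "real q * real (n choose q) = real n * D" unfolding D_def by (metis of_nat_mult)
  have "E * (16 * (real q)\<^sup>2) \<le> E * d" using dq E0 by (intro mult_left_mono)
  also have "\<dots> \<le> real q * real s" using ks unfolding step[symmetric] by (intro mult_left_mono) auto
  finally have "real q * (16 * real q * E) \<le> real q * real s" by (simp add: power2_eq_square mult_ac)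
  then have 1: "16 * real q * E \<le> real s" using q0 by simp
  have 2: "16 * real q * E \<le> D"
  \<comment> \<open>The constant 1024 is 64 times 16: 16 is the factor to be won, and 64 leaves room
    in the second case for k \<le> 2 d and n - 1 \<ge> n / 2.\<close>
  proof (cases "real n \<le> 64 * real q * d")
    case True
    have "E * d \<le> real q * real s" using ks unfolding step[symmetric] by (intro mult_left_mono) auto
    also have "\<dots> \<le> real q * (real (n choose q) / (1024 * (real q)\<^sup>2))" using sn by (intro mult_left_mono) auto
    also have "\<dots> = real n * D / (1024 * (real q)\<^sup>2)" using nD by simp
    also have "\<dots> \<le> 64 * real q * d * D / (1024 * (real q)\<^sup>2)"
      using True D0 by (intro divide_right_mono mult_right_mono) auto
    also have "\<dots> = d * (D / (16 * real q))" using q0 by (simp add: power2_eq_square field_simps)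
    finally have "d * E \<le> d * (D / (16 * real q))" by (simp add: mult.commute)
    then have "E \<le> D / (16 * real q)" by (rule mult_left_le_imp_le[OF _ d0])
    then show ?thesis using q0 by (simp add: field_simps)
  next
    case False
    have n1: "real (n - 1) = real n - 1" "2 \<le> real n" using k q by auto
    have "real (n - 1) * E \<le> real k * D"
      using binomial_ratio_le[of "q - 1" k "n - 1"] k q unfolding E_def D_def by simp
    also have "\<dots> \<le> 2 * d * D" using dq(2) D0 by (intro mult_right_mono)
    finally have "16 * real q * (real (n - 1) * E) \<le> 16 * real q * (2 * d * D)" using q0 by (intro mult_left_mono) auto
    also have "\<dots> = (32 * real q * d) * D" by simp
    also have "\<dots> \<le> real (n - 1) * D" using False n1 D0 by (intro mult_right_mono) auto
    finally have "real (n - 1) * (16 * real q * E) \<le> real (n - 1) * D" by (simp add: mult_ac)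
    then show ?thesis using n1 by simp
  qed
  show ?thesis using 1 2 unfolding E_def D_def by simp
qed

lemma binomial_Suc_Suc_split:
  assumes "2 \<le> r"
  shows "(n + 2) choose r = (n choose r) + 2 * (n choose (r - 1)) + (n choose (r - 2))"
proof -
  obtain j where "r = Suc (Suc j)" using assms by (metis Suc_le_D numeral_2_eq_2 Suc_le_mono)
  then show ?thesis by simp
qed

lemma half_inverse_bounds:
  fixes x :: real
  assumes "0 \<le> x"
  shows "0 < 1 / (2 * (x + 1))" "1 / (2 * (x + 1)) < 1" "1 / (2 * (x + 1)) * x < 1 / 2"
  using assms by (auto simp: field_simps)

text \<open>The star is only known to win by 1. Half of this pays for \<epsilon> X, where X \<le> q
  S^2 is the sum guaranteed for the star, and half for the mean correction, small since n is large
  against (q S)^2. As \<epsilon> involves q and S alone, it can be fixed before n.\<close>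

lemma degsq_gap_small:
  fixes q n s S :: nat
  assumes q: "2 \<le> q" and s: "q + 2 \<le> s" "s \<le> S" "s \<le> n choose q"
    and n: "q + S \<le> n" "2 * (real q * real S)\<^sup>2 \<le> real n"
  shows "\<exists>H \<subseteq> ksets {1..n} q. card H = s \<and> degsq n (colex_initial s q)
    < (1 - 1 / (2 * (real q * (real S)\<^sup>2 + 1))) * (degsq n H - (real q * real s)\<^sup>2 / real n)"
proof -
  define \<epsilon> where "\<epsilon> = 1 / (2 * (real q * (real S)\<^sup>2 + 1))"
  define X where "X = (real q - 1) * (real s)\<^sup>2 + real s"
  define a where "a = (real q * real s)\<^sup>2 / real n"
  obtain H where H: "H \<subseteq> ksets {1..n} q" "card H = s" "X \<le> degsq n H"
  proof -
    have "q - 1 + s \<le> n" "1 \<le> q" using q s n by linarith+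
    then show ?thesis using exists_star that unfolding X_def by blast
  qed
  have sS: "(real s)\<^sup>2 \<le> (real S)\<^sup>2" using s by (intro power_mono) auto
  have "real s \<le> (real s)\<^sup>2" using s by (simp add: power2_eq_square)
  then have "X \<le> real q * (real s)\<^sup>2" unfolding X_def by (simp add: algebra_simps)
  also have "\<dots> \<le> real q * (real S)\<^sup>2" using sS by (intro mult_left_mono) auto
  finally have X: "X \<le> real q * (real S)\<^sup>2" .
  have e: "0 < \<epsilon>" "\<epsilon> < 1" unfolding \<epsilon>_def by (rule half_inverse_bounds, simp)+
  have "\<epsilon> * X \<le> \<epsilon> * (real q * (real S)\<^sup>2)" using X e by (intro mult_left_mono) auto
  also have "\<dots> < 1 / 2" unfolding \<epsilon>_def by (rule half_inverse_bounds) simp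
  finally have eX: "\<epsilon> * X < 1 / 2" .
  have n0: "0 < real n" using n q by simp
  have "(real q * real s)\<^sup>2 \<le> (real q * real S)\<^sup>2" using s by (intro power_mono mult_left_mono) auto
  then have a: "a \<le> 1 / 2" using n n0 unfolding a_def by (simp add: field_simps)
  have a0: "0 \<le> a" unfolding a_def by simp
  have "degsq n (colex_initial s q) \<le> X - 1"
    using degsq_colex_initial_small[OF q s(1,3)] unfolding X_def .
  also have "\<dots> < X - \<epsilon> * X - a" using eX a by linarith
  also have "\<dots> \<le> (1 - \<epsilon>) * (X - a)" using e a0 by (simp add: algebra_simps)
  also have "\<dots> \<le> (1 - \<epsilon>) * (degsq n H - a)" using H(3) e by (intro mult_left_mono) auto
  finally show ?thesis using H unfolding \<epsilon>_def a_def by blast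
qed

text \<open>With \<mu> = min s D the competitor has at least s \<mu> / 2, the mean correction takes
  at most s \<mu> / 4, and half of the difference is s \<mu> / 8; colex stays at s \<mu> /
  16.\<close>

lemma degsq_gap_large:
  fixes q n s :: nat
  assumes q: "2 \<le> q" and s: "(16 * q\<^sup>2 + 2 * q) choose q < s"
    and sn: "real s \<le> real (n choose q) / (1024 * (real q)\<^sup>2)" and n: "4 * q\<^sup>2 \<le> n"
  shows "\<exists>H \<subseteq> ksets {1..n} q. card H = s \<and> degsq n (colex_initial s q)
    < (1 - 1 / 2) * (degsq n H - (real q * real s)\<^sup>2 / real n)"
proof -
  define D where "D = real ((n - 1) choose (q - 1))"
  define \<mu> where "\<mu> = min (real s) D"
  have q0: "0 < real q" "2 \<le> real q" using q by auto
  have s0: "0 < real s" using s by simp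
  have q2: "4 \<le> (real q)\<^sup>2" using power_mono[OF q0(2), of 2] by simp
  have "real s * 1 < real s * (1024 * (real q)\<^sup>2)" using s0 q2 by (intro mult_strict_left_mono) auto
  also have "\<dots> \<le> real (n choose q)" using sn q0 by (simp add: field_simps)
  finally have sC: "s < n choose q" by simp
  have "0 choose q = 0" using q by (intro binomial_eq_0) auto
  then have "\<not> s < 0 choose q" by linarith
  \<comment> \<open>\<open>Suc k\<close> is the least ground set size with more than s sets of size
    q, so that C(k, q) \<le> s < C(k+1, q).\<close>
  with sC obtain k where k: "k < n" "\<forall>i\<le>k. \<not> s < i choose q" "s < Suc k choose q"
    using ex_least_nat_less[of "\<lambda>j. s < j choose q" n] by blast
  have ks: "k choose q \<le> s" using k(2) by (simp add: not_less)
  have kb: "16 * q\<^sup>2 + 2 * q \<le> k"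
  proof (rule ccontr)
    assume "\<not> 16 * q\<^sup>2 + 2 * q \<le> k"
    then have "Suc k choose q \<le> (16 * q\<^sup>2 + 2 * q) choose q" by (intro binomial_right_mono) auto
    then show False using k(3) s by linarith
  qed
  have n0: "0 < real n" using k by simp
  have "q * (n choose q) = n * ((n - 1) choose (q - 1))" using q by (intro times_binomial_minus1_eq) auto
  then have nD: "real q * real (n choose q) = real n * D" unfolding D_def by (metis of_nat_mult)
  have "0 < n choose q" using sC by linarith
  then have "0 < real (n choose q)" by (simp only: of_nat_0_less_iff)
  then have "0 < real q * real (n choose q)" using q0 by (intro mult_pos_pos)
  then have D: "0 < D" unfolding nD using n0 by (simp add: zero_less_mult_iff)
  have \<mu>: "0 < \<mu>" unfolding \<mu>_def using s0 D by simp
  obtain H where H: "H \<subseteq> ksets {1..n} q" "card H = s" "real s * \<mu> / 2 \<le> degsq n H"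
    using exists_high_degsq[of q n s] q sC k unfolding \<mu>_def D_def by force
  have "degsq n (colex_initial s q) \<le> real (k choose (q - 1)) * (real q * real s)"
    using degsq_colex_initial_le[of q s k n] q k by simp
  also have "\<dots> = (real s / 16) * (16 * real q * real (k choose (q - 1)))" by simp
  also have "\<dots> \<le> (real s / 16) * \<mu>"
    using shadow_binomial_le[OF q kb k(1) ks sn] unfolding \<mu>_def D_def by (intro mult_left_mono) auto
  also have "\<dots> < real s * \<mu> / 8" using s0 \<mu> by simp
  finally have up: "degsq n (colex_initial s q) < real s * \<mu> / 8" .
  \<comment> \<open>One bound for each argument of the minimum: 4 q^2 \<le> n against s, the small
    proportion of s among all q-sets against D.\<close>
  have "(real q)\<^sup>2 * real s / real n \<le> \<mu> / 4"
  proof -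
    have "real (4 * q\<^sup>2) \<le> real n" using n by (simp only: of_nat_le_iff)
    then have "4 * (real q)\<^sup>2 * real s \<le> real n * real s" using s0 by (intro mult_right_mono) auto
    then have 1: "(real q)\<^sup>2 * real s / real n \<le> real s / 4" using n0 by (simp add: field_simps)
    have "(real q)\<^sup>2 * real s \<le> (real q)\<^sup>2 * (real (n choose q) / (1024 * (real q)\<^sup>2))"
      using sn by (intro mult_left_mono) auto
    also have "\<dots> = real (n choose q) / 1024" using q0 by simp
    also have "\<dots> \<le> real q * real (n choose q) / 4"
    proof -
      have "1 * real (n choose q) \<le> real q * real (n choose q)" using q0 by (intro mult_right_mono) auto
      then show ?thesis by simp
    qed
    also have "\<dots> = real n * D / 4" unfolding nD ..
    finally have 2: "(real q)\<^sup>2 * real s / real n \<le> D / 4" using n0 by (simp add: field_simps)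
    show ?thesis using 1 2 unfolding \<mu>_def by linarith
  qed
  then have "real s * ((real q)\<^sup>2 * real s / real n) \<le> real s * (\<mu> / 4)" by (intro mult_left_mono) auto
  then have "(real q * real s)\<^sup>2 / real n \<le> real s * \<mu> / 4"
    by (simp add: power2_eq_square mult_ac)
  then have "degsq n (colex_initial s q) < (1 - 1 / 2) * (degsq n H - (real q * real s)\<^sup>2 / real n)"
    using up H(3) by simp
  then show ?thesis using H by blast
qed

theorem theorem1p3:
  fixes r :: nat
  assumes "r \<ge> 4"
  shows "\<exists>\<alpha>::real. \<alpha> > 0 \<and> (\<exists>t0::nat. \<forall>t\<ge>t0. \<forall>s::int. \<forall>m::nat.
           int r \<le> s \<and> real_of_int s \<le> \<alpha> * real ((t - 2) choose (r - 2)) \<and>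
           int m = int (t choose r) - int ((t - 2) choose (r - 2)) + s \<longrightarrow>
           (\<exists>G. r_graph r G \<and> card G = m \<and> lagrangian G > lagrangian (colex_initial m r)))"
proof -
  define q where "q = r - 2"
  have q: "2 \<le> q" "r = q + 2" and r2: "2 \<le> r" using assms unfolding q_def by auto
  have q0: "2 \<le> real q" using q by simp
  \<comment> \<open>Beyond this many edges colex spans enough vertices for
    \<open>shadow_binomial_le\<close>. It depends on r only, so \<epsilon>, \<open>\<rho>1\<close>
    and \<open>n1\<close> for the bounded range can be chosen afterwards.\<close>
  define S where "S = (16 * q\<^sup>2 + 2 * q) choose q"
  define \<epsilon> where "\<epsilon> = 1 / (2 * (real q * (real S)\<^sup>2 + 1))"
  have e: "0 < \<epsilon>" "\<epsilon> < 1" unfolding \<epsilon>_def by (rule half_inverse_bounds, simp)+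
  obtain \<rho>1 n1 where \<rho>1: "0 < \<rho>1" and less1: "\<And>n C H. n1 \<le> n \<Longrightarrow> C \<subseteq> ksets {1..n} (r - 2) \<Longrightarrow> H \<subseteq> ksets {1..n} (r - 2) \<Longrightarrow>
    card C = card H \<Longrightarrow> real (card H) \<le> \<rho>1 * real n ^ (r - 2) \<Longrightarrow>
    degsq n C < (1 - \<epsilon>) * (degsq n H - (real (r - 2) * real (card H))\<^sup>2 / real n) \<Longrightarrow>
    lagrangian (joined n r C) < lagrangian (joined n r H)"
    by (rule lagrangian_joined_less[OF assms e]) blast
  obtain \<rho>2 n2 where \<rho>2: "0 < \<rho>2" and less2: "\<And>n C H. n2 \<le> n \<Longrightarrow> C \<subseteq> ksets {1..n} (r - 2) \<Longrightarrow> H \<subseteq> ksets {1..n} (r - 2) \<Longrightarrow>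
    card C = card H \<Longrightarrow> real (card H) \<le> \<rho>2 * real n ^ (r - 2) \<Longrightarrow>
    degsq n C < (1 - 1 / 2) * (degsq n H - (real (r - 2) * real (card H))\<^sup>2 / real n) \<Longrightarrow>
    lagrangian (joined n r C) < lagrangian (joined n r H)"
    by (rule lagrangian_joined_less[OF assms, of "1 / 2"]) (simp, simp, blast)
  \<comment> \<open>\<open>\<rho>2\<close> keeps large s within reach of the expansion; the second
    bound is the proportion that \<open>degsq_gap_large\<close> asks for.\<close>
  define \<alpha> where "\<alpha> = min \<rho>2 (1 / (1024 * (real q)\<^sup>2))"
  have \<alpha>: "0 < \<alpha>" unfolding \<alpha>_def using \<rho>2 q0 by simp
  \<comment> \<open>Up to \<open>S\<close> edges the density condition s \<le> \<rho>1 n^q follows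
    from n \<ge> S / \<rho>1 and puts no demand on \<alpha>.\<close>
  define n0 where "n0 = max (max n1 n2) (max (max (q + S) (nat \<lceil>2 * (real q * real S)\<^sup>2\<rceil>)) (max (nat \<lceil>real S / \<rho>1\<rceil>) (4 * q\<^sup>2)))"
  show ?thesis
  proof (intro exI[of _ \<alpha>] exI[of _ "n0 + 2"] conjI allI impI \<alpha>)
    fix t :: nat and s :: int and m :: nat
    assume t: "n0 + 2 \<le> t" and as: "int r \<le> s \<and> real_of_int s \<le> \<alpha> * real ((t - 2) choose (r - 2)) \<and>
           int m = int (t choose r) - int ((t - 2) choose (r - 2)) + s"
    define n where "n = t - 2"
    have tn: "t = n + 2" using t unfolding n_def by simp
    have "n0 \<le> n" using t tn by simp
    then have n: "n1 \<le> n" "n2 \<le> n" "q + S \<le> n" "2 * (real q * real S)\<^sup>2 \<le> real n" "real S / \<rho>1 \<le> real n" "4 * q\<^sup>2 \<le> n"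
      unfolding n0_def by linarith+
    define s' where "s' = nat s"
    have s': "s = int s'" "r \<le> s'" using as unfolding s'_def by auto
    have s\<alpha>: "real s' \<le> \<alpha> * real (n choose q)" using as unfolding s'(1) q_def n_def by simp
    also have "\<dots> \<le> 1 / (1024 * (real q)\<^sup>2) * real (n choose q)"
      unfolding \<alpha>_def by (intro mult_right_mono) auto
    finally have sn: "real s' \<le> real (n choose q) / (1024 * (real q)\<^sup>2)" by simp
    have "1 \<le> 1024 * (real q)\<^sup>2" using power_mono[OF q0, of 2] by simp
    then have "real (n choose q) / (1024 * (real q)\<^sup>2) \<le> real (n choose q) / 1"
      using q by (intro divide_left_mono) auto
    then have sC: "s' \<le> n choose q" using sn by linarith
    have m: "m = (n choose r) + 2 * (n choose (r - 1)) + s'"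
      using as binomial_Suc_Suc_split[OF r2, of n] unfolding tn s'(1) by simp
    define C where "C = colex_initial s' q"
    have C: "C \<subseteq> ksets {1..n} (r - 2)"
      using colex_initial_mono[OF sC, of q] unfolding C_def colex_initial_binomial q_def .
    have cardC: "card C = s'" unfolding C_def by (rule card_colex_initial[OF sC])
    have colex: "colex_initial m r = joined n r C"
      using colex_initial_joined[OF r2, of s' n] sC unfolding m C_def q_def by simp
    have "\<exists>H. H \<subseteq> ksets {1..n} (r - 2) \<and> card H = s' \<and> lagrangian (joined n r C) < lagrangian (joined n r H)"
    proof (cases "s' \<le> S")
      case True
      \<comment> \<open>This is r \<le> s: colex then has an edge beyond the q-subsets of
        {1..q+1}.\<close>
      have "q + 2 \<le> s'" using s'(2) q by simp
      from degsq_gap_small[OF q(1) this True sC n(3,4)] obtain H where H: "H \<subseteq> ksets {1..n} q" "card H = s'"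
        "degsq n C < (1 - \<epsilon>) * (degsq n H - (real q * real s')\<^sup>2 / real n)" unfolding \<epsilon>_def C_def by blast
      have "real s' \<le> \<rho>1 * real n ^ q"
      proof -
        have "real s' \<le> real S" using True by simp
        also have "\<dots> \<le> \<rho>1 * real n" using n(5) \<rho>1 by (simp add: field_simps)
        also have "\<dots> \<le> \<rho>1 * real n ^ q" using \<rho>1 n(3) q by (intro mult_left_mono self_le_power) auto
        finally show ?thesis .
      qed
      then have "lagrangian (joined n r C) < lagrangian (joined n r H)"
        using H C cardC n(1) by (intro less1) (auto simp: q_def)
      then show ?thesis using H unfolding q_def by blast
    next
      case False
      then have "(16 * q\<^sup>2 + 2 * q) choose q < s'" unfolding S_def by simp
      from degsq_gap_large[OF q(1) this sn n(6)] obtain H where H: "H \<subseteq> ksets {1..n} q" "card H = s'"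
        "degsq n C < (1 - 1 / 2) * (degsq n H - (real q * real s')\<^sup>2 / real n)" unfolding C_def by blast
      have "real s' \<le> \<rho>2 * real n ^ q"
      proof -
        have "\<alpha> * real (n choose q) \<le> \<rho>2 * real n ^ q"
          using \<rho>2 binomial_le_power[of n q] unfolding \<alpha>_def by (intro mult_mono) auto
        then show ?thesis using s\<alpha> by linarith
      qed
      then have "lagrangian (joined n r C) < lagrangian (joined n r H)"
        using H C cardC n(2) by (intro less2) (auto simp: q_def)
      then show ?thesis using H unfolding q_def by blast
    qed
    then obtain H where H: "H \<subseteq> ksets {1..n} (r - 2)" "card H = s'"
      "lagrangian (joined n r C) < lagrangian (joined n r H)" by blast
    have "card (joined n r H) = m" unfolding card_joined[OF H(1)] H(2) m ..
    then show "\<exists>G. r_graph r G \<and> card G = m \<and> lagrangian G > lagrangian (colex_initial m r)"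
      using r_graph_joined[OF H(1) r2] H(3) unfolding colex by blast
  qed
qed

end
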